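(* For any prime $p$ and any $\beta_1,\beta_2\in\mathbb Z$ we have $$\int_{\substack{\mathbf t\in\mathbb Q_p^2\\ v_p(t_i)=\beta_i,\ i=1,2}}(t_1,t_2)'_p\,\mathrm d\mathbf t=0.$$
   Context: $v_p$ is the $p$-adic valuation, and the Haar measure on $\mathbb Q_p$ is normalised so that $\mathbb Z_p$ has measure $1$. For $a,b\in\mathbb Q_p^\times$ the Hilbert symbol $(a,b)_{\mathbb Q_p}\in\{\pm1\}$ is $1$ if the plane conic $z^2=ax^2+by^2$ has a $\mathbb Q_p$-rational point and $-1$ otherwise. For $t_1,t_2\in\mathbb Q_p$ define $(t_1,t_2)'_p\in\{-1,0,1\}\subseteq\mathbb{Z}$ to be: $0$ if $t_1=0$ or $t_2=0$; $0$ if $p$ is odd and $v_p(t_1),v_p(t_2)$ are both even; $0$ if $p=2$, $v_2(t_1),v_2(t_2)$ are both even and $t_1/2^{v_2(t_1)}\not\equiv t_2/2^{v_2(t_2)}\bmod4$; and $(t_1,t_2)_{\mathbb Q_p}$ otherwise. *)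

theory Defs
  imports
    "HOL-Probability.Probability"
    "HOL-Computational_Algebra.Fraction_Field"
    "Berlekamp_Zassenhaus.Finite_Field"
begin

text \<open>The prime \<open>p\<close> is carried by a type variable \<open>'p :: prime_card\<close>, with \<open>p = CARD('p)\<close>;
  every prime is the cardinality of some type, and \<open>prime_card\<close> demands nothing else, so that a
  statement about an arbitrary \<open>'p\<close> is a statement about an arbitrary prime.

  \<open>'p padic_int\<close> is the inverse limit of the rings \<open>\<int>/p\<^sup>n\<int>\<close>, whose elements are represented by
  their residues in \<open>{0..<p\<^sup>n}\<close>: the defining equation makes \<open>x n\<close> reduced modulo \<open>p\<^sup>n\<close>.\<close>

typedef (overloaded) 'p padic_int =
  "{x :: nat \<Rightarrow> int. \<forall>n. x n = x (Suc n) mod int CARD('p::prime_card) ^ n}"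
  morphisms residue Abs_padic_int
  by (rule exI[of _ "\<lambda>_. 0"]) simp

setup_lifting type_definition_padic_int

lemma residue_Abs_padic_int:
  assumes "\<And>n. y n = y (Suc n) mod int CARD('p::prime_card) ^ n"
  shows "residue (Abs_padic_int y :: 'p padic_int) = y"
  by (rule Abs_padic_int_inverse) (use assms in blast)

lemma prime_card_gt_1_int: "1 < int CARD('p::prime_card)"
  by (rule prime_gt_1_int[OF prime_card_int])

lemma mod_power_Suc_mod: "(a mod p ^ Suc n) mod p ^ n = a mod (p::int) ^ n"
  by (rule mod_mod_cancel) (simp add: le_imp_power_dvd)

lemma residue_mod:
  fixes x :: "'p::prime_card padic_int"
  assumes "m \<le> n"
  shows "residue x n mod int CARD('p) ^ m = residue x m"
  using assms
proof (induction n rule: dec_induct)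
  case base
  have "residue x m = residue x (Suc m) mod int CARD('p) ^ m" using residue[of x] by blast
  then show ?case by (metis mod_mod_trivial)
next
  case (step n)
  have "residue x n = residue x (Suc n) mod int CARD('p) ^ n" using residue[of x] by blast
  moreover have "int CARD('p) ^ m dvd int CARD('p) ^ n" using step by (simp add: le_imp_power_dvd)
  ultimately show ?case using step by (metis mod_mod_cancel)
qed

lemma residue_bounds:
  fixes x :: "'p::prime_card padic_int"
  shows "0 \<le> residue x n" "residue x n < int CARD('p) ^ n"
proof -
  have p: "0 < int CARD('p) ^ n" using prime_card_gt_1_int[where 'p = 'p] by simp
  have "residue x n = residue x n mod int CARD('p) ^ n" by (simp add: residue_mod)
  then show "0 \<le> residue x n" "residue x n < int CARD('p) ^ n" using p
    by (metis pos_mod_sign, metis pos_mod_bound)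
qed

lemma residue_0 [simp]: "residue x 0 = 0"
  using residue_bounds[of x 0] by simp

lemma padic_int_eqI: "(\<And>n. residue x n = residue y n) \<Longrightarrow> x = y"
  by (simp add: residue_inject[symmetric] fun_eq_iff)

lemma residue_mod_self [simp]:
  fixes x :: "'p::prime_card padic_int"
  shows "residue x n mod int CARD('p) ^ n = residue x n"
  by (simp add: residue_mod)

instantiation padic_int :: (prime_card) comm_ring_1
begin

lift_definition zero_padic_int :: "'a padic_int" is "\<lambda>_. 0" by simp

lift_definition one_padic_int :: "'a padic_int" is "\<lambda>n. 1 mod int CARD('a) ^ n"
  by (metis mod_power_Suc_mod)

lift_definition plus_padic_int :: "'a padic_int \<Rightarrow> 'a padic_int \<Rightarrow> 'a padic_int"
  is "\<lambda>x y n. (x n + y n) mod int CARD('a) ^ n"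
  by (metis mod_power_Suc_mod mod_add_eq)

lift_definition uminus_padic_int :: "'a padic_int \<Rightarrow> 'a padic_int"
  is "\<lambda>x n. (- x n) mod int CARD('a) ^ n"
  by (metis mod_power_Suc_mod mod_minus_eq)

lift_definition minus_padic_int :: "'a padic_int \<Rightarrow> 'a padic_int \<Rightarrow> 'a padic_int"
  is "\<lambda>x y n. (x n - y n) mod int CARD('a) ^ n"
  by (metis mod_power_Suc_mod mod_diff_eq)

lift_definition times_padic_int :: "'a padic_int \<Rightarrow> 'a padic_int \<Rightarrow> 'a padic_int"
  is "\<lambda>x y n. (x n * y n) mod int CARD('a) ^ n"
  by (metis mod_power_Suc_mod mod_mult_eq)

lemmas padic_int_ops_rep_eq = zero_padic_int.rep_eq one_padic_int.rep_eq plus_padic_int.rep_eq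
  uminus_padic_int.rep_eq minus_padic_int.rep_eq times_padic_int.rep_eq

instance
proof
  fix a b c :: "'a padic_int"
  note [simp] = padic_int_ops_rep_eq
  show "a * b * c = a * (b * c)" by (rule padic_int_eqI) (simp add: mod_simps mult.assoc)
  show "a * b = b * a" by (rule padic_int_eqI) (simp add: mult.commute)
  show "1 * a = a" by (rule padic_int_eqI) (simp add: mod_simps)
  show "a + b + c = a + (b + c)" by (rule padic_int_eqI) (simp add: mod_simps add.assoc)
  show "a + b = b + a" by (rule padic_int_eqI) (simp add: add.commute)
  show "0 + a = a" by (rule padic_int_eqI) simp
  show "- a + a = 0" by (rule padic_int_eqI) (simp add: mod_simps)
  show "a - b = a + - b" by (rule padic_int_eqI) (simp add: mod_simps)
  show "(a + b) * c = a * c + b * c" by (rule padic_int_eqI) (simp add: mod_simps distrib_right)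
  have "residue (0 :: 'a padic_int) 1 \<noteq> residue (1 :: 'a padic_int) 1"
    using prime_card_gt_1_int[where 'p = 'a] by simp
  then show "(0 :: 'a padic_int) \<noteq> 1" by metis
qed

end

lemma prime_power_not_dvd_mult:
  fixes p x y :: int
  assumes "prime p" "\<not> p ^ Suc a dvd x" "\<not> p ^ Suc b dvd y"
  shows "\<not> p ^ Suc (a + b) dvd x * y"
proof
  assume d: "p ^ Suc (a + b) dvd x * y"
  from assms have "x \<noteq> 0" "y \<noteq> 0" by auto
  moreover have "\<not> is_unit p" using assms(1) by auto
  moreover have "prime_elem p" using assms(1) by auto
  ultimately have "Suc (a + b) \<le> multiplicity p x + multiplicity p y"
    using d prime_elem_multiplicity_mult_distrib[of p x y] multiplicity_geI[of "x * y" p "Suc (a + b)"]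
    by (simp del: power_Suc)
  moreover have "multiplicity p x < Suc a" "multiplicity p y < Suc b"
    using assms(2,3) multiplicity_dvd'[of _ p] by (meson not_le)+
  ultimately show False by simp
qed

instance padic_int :: (prime_card) idom
proof
  fix x y :: "'a padic_int"
  let ?p = "int CARD('a)"
  have nd: "\<exists>a. \<forall>n\<ge>a. \<not> ?p ^ Suc a dvd residue z (Suc n)" if nz: "z \<noteq> 0" for z :: "'a padic_int"
  proof -
    have "\<exists>m. residue z m \<noteq> residue (0 :: 'a padic_int) m" using nz padic_int_eqI by blast
    then obtain m where m: "residue z m \<noteq> 0" by (auto simp: zero_padic_int.rep_eq)
    then obtain a where a: "m = Suc a" by (cases m) auto
    have "\<not> ?p ^ Suc a dvd residue z (Suc n)" if "n \<ge> a" for n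
      using residue_mod[of m "Suc n" z] that m a by (auto simp: mod_eq_0_iff_dvd[symmetric])
    then show ?thesis by blast
  qed
  assume "x \<noteq> 0" "y \<noteq> 0"
  with nd obtain a b where
    ab: "\<And>n. n \<ge> a \<Longrightarrow> \<not> ?p ^ Suc a dvd residue x (Suc n)" "\<And>n. n \<ge> b \<Longrightarrow> \<not> ?p ^ Suc b dvd residue y (Suc n)"
    by meson
  have "\<not> ?p ^ Suc (a + b) dvd residue x (Suc (a + b)) * residue y (Suc (a + b))"
    by (rule prime_power_not_dvd_mult) (use prime_card_int ab in auto)
  then have "residue (x * y) (Suc (a + b)) \<noteq> 0"
    by (simp add: times_padic_int.rep_eq mod_eq_0_iff_dvd del: power_Suc)
  then show "x * y \<noteq> 0" by (auto simp: zero_padic_int.rep_eq)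
qed

text \<open>\<open>\<rat>\<^sub>p\<close> as the fraction field of \<open>\<int>\<^sub>p\<close>. It is a copy of the type of fractions, so that it can
  be given its own topology.\<close>

typedef (overloaded) 'p padic = "UNIV :: 'p::prime_card padic_int fract set" ..

setup_lifting type_definition_padic

instantiation padic :: (prime_card) field
begin
lift_definition zero_padic :: "'a padic" is 0 .
lift_definition one_padic :: "'a padic" is 1 .
lift_definition plus_padic :: "'a padic \<Rightarrow> 'a padic \<Rightarrow> 'a padic" is "(+)" .
lift_definition minus_padic :: "'a padic \<Rightarrow> 'a padic \<Rightarrow> 'a padic" is "(-)" .
lift_definition uminus_padic :: "'a padic \<Rightarrow> 'a padic" is uminus .
lift_definition times_padic :: "'a padic \<Rightarrow> 'a padic \<Rightarrow> 'a padic" is "(*)" .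
lift_definition inverse_padic :: "'a padic \<Rightarrow> 'a padic" is inverse .
lift_definition divide_padic :: "'a padic \<Rightarrow> 'a padic \<Rightarrow> 'a padic" is "(/)" .
instance
  by standard (transfer; simp add: algebra_simps divide_inverse)+
end

definition of_padic_int :: "'p::prime_card padic_int \<Rightarrow> 'p padic" where
  "of_padic_int x = Abs_padic (Fract x 1)"

definition Zp :: "'p::prime_card padic set" where "Zp = range of_padic_int"

lemma of_padic_int_add: "of_padic_int (x + y) = of_padic_int x + of_padic_int y"
  unfolding of_padic_int_def plus_padic_def by (simp add: Abs_padic_inverse)

lemma of_padic_int_mult: "of_padic_int (x * y) = of_padic_int x * of_padic_int y"
  unfolding of_padic_int_def times_padic_def by (simp add: Abs_padic_inverse)

lemma of_padic_int_minus: "of_padic_int (- x) = - of_padic_int x"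
  unfolding of_padic_int_def uminus_padic_def by (simp add: Abs_padic_inverse)

lemma of_padic_int_0 [simp]: "of_padic_int 0 = 0"
  unfolding of_padic_int_def zero_padic_def by (simp add: Zero_fract_def)

lemma of_padic_int_1 [simp]: "of_padic_int 1 = 1"
  unfolding of_padic_int_def one_padic_def by (simp add: One_fract_def)

lemma of_padic_int_diff: "of_padic_int (x - y) = of_padic_int x - of_padic_int y"
  by (simp only: diff_conv_add_uminus of_padic_int_add of_padic_int_minus)

lemma of_padic_int_of_nat [simp]: "of_padic_int (of_nat n) = of_nat n"
  by (induction n) (simp_all add: of_padic_int_add)

lemma of_padic_int_power: "of_padic_int (x ^ n) = of_padic_int x ^ n"
  by (induction n) (simp_all add: of_padic_int_mult)

lemma of_padic_int_eq_iff [simp]: "of_padic_int x = of_padic_int y \<longleftrightarrow> x = y"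
  unfolding of_padic_int_def by (simp add: Abs_padic_inject eq_fract)

lemma residue_of_nat:
  "residue (of_nat k :: 'p::prime_card padic_int) n = int k mod int CARD('p) ^ n"
proof (induction k)
  case (Suc k)
  then show ?case
    by (simp add: plus_padic_int.rep_eq one_padic_int.rep_eq mod_simps)
qed (simp add: zero_padic_int.rep_eq)

lemma of_nat_prime_padic_int_nonzero [simp]:
  "(of_nat CARD('p) :: 'p::prime_card padic_int) \<noteq> 0"
proof -
  have p: "1 < int CARD('p)" using prime_card_gt_1_int .
  then have "int CARD('p) < int CARD('p) ^ 2" by (simp add: power2_eq_square)
  then have "residue (of_nat CARD('p) :: 'p padic_int) 2 \<noteq> 0" using p
    by (simp add: residue_of_nat)
  then show ?thesis by (auto simp: zero_padic_int.rep_eq)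
qed

lemma of_nat_prime_padic_nonzero [simp]: "(of_nat CARD('p) :: 'p::prime_card padic) \<noteq> 0"
  by (metis of_nat_prime_padic_int_nonzero of_padic_int_0 of_padic_int_eq_iff of_padic_int_of_nat)

lemma padic_int_dvd_power:
  fixes x :: "'p::prime_card padic_int"
  assumes "residue x k = 0"
  shows "\<exists>y. x = of_nat CARD('p) ^ k * y"
proof -
  let ?p = "int CARD('p)"
  have p: "0 < ?p" using prime_card_gt_1_int[where 'p = 'p] by simp
  have d: "?p ^ k dvd residue x (n + k)" for n
    using residue_mod[of k "n + k" x] assms by (simp add: mod_eq_0_iff_dvd)
  define y where "y n = residue x (n + k) div ?p ^ k" for n
  have y: "residue x (n + k) = ?p ^ k * y n" for n
    using d[of n] by (simp add: y_def)
  have "y n = y (Suc n) mod ?p ^ n" for n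
  proof -
    have "?p ^ k * y n = residue x (Suc n + k) mod ?p ^ (n + k)"
      unfolding y[symmetric] by (simp add: residue_mod)
    also have "\<dots> = (?p ^ k * y (Suc n)) mod (?p ^ k * ?p ^ n)"
      by (simp only: y power_add mult.commute)
    also have "\<dots> = ?p ^ k * (y (Suc n) mod ?p ^ n)" by (rule mult_mod_right[symmetric])
    finally show ?thesis using p by simp
  qed
  then have yr: "residue (Abs_padic_int y :: 'p padic_int) = y"
    by (rule residue_Abs_padic_int)
  have "x = of_nat (CARD('p) ^ k) * Abs_padic_int y"
  proof (rule padic_int_eqI)
    fix n
    have "residue (of_nat (CARD('p) ^ k) * (Abs_padic_int y :: 'p padic_int)) n = (?p ^ k * y n) mod ?p ^ n"
      by (simp add: times_padic_int.rep_eq residue_of_nat yr mod_simps del: of_nat_power)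
        (simp add: mod_simps)
    also have "\<dots> = residue x n" by (simp only: y[symmetric]) (simp add: residue_mod)
    finally show "residue x n = residue (of_nat (CARD('p) ^ k) * (Abs_padic_int y :: 'p padic_int)) n" by simp
  qed
  then have "x = of_nat CARD('p) ^ k * Abs_padic_int y" by simp
  then show ?thesis by blast
qed

lemma padic_int_unit:
  fixes x :: "'p::prime_card padic_int"
  assumes "residue x 1 \<noteq> 0"
  shows "\<exists>y. x * y = 1"
proof -
  let ?p = "int CARD('p)"
  have p: "1 < ?p" using prime_card_gt_1_int[where 'p = 'p] by simp
  have "\<exists>b. (residue x n * b) mod ?p ^ n = 1 mod ?p ^ n" for n
  proof (cases n)
    case (Suc m)
    then have "\<not> ?p dvd residue x n" using residue_mod[of 1 n x] assms
      by (auto simp: mod_eq_0_iff_dvd[symmetric])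
    then have "coprime ?p (residue x n)"
      using prime_card_int[where 'a = 'p] by (intro prime_imp_coprime) auto
    then have "coprime (residue x n) (?p ^ n)" by (simp add: coprime_commute)
    then show ?thesis using cong_solve_coprime_int[of "residue x n" "?p ^ n"] by (auto simp: cong_def)
  qed simp
  then obtain b where b: "\<And>n. (residue x n * b n) mod ?p ^ n = 1 mod ?p ^ n" by metis
  have uniq: "c mod ?p ^ n = d mod ?p ^ n"
    if "(residue x n * c) mod ?p ^ n = 1 mod ?p ^ n" "(residue x n * d) mod ?p ^ n = 1 mod ?p ^ n" for c d n
  proof -
    have "[c = c * (residue x n * d)] (mod ?p ^ n)"
      using that(2) cong_scalar_left[of "residue x n * d" 1 "?p ^ n" c] by (simp add: cong_def)
    also have "[c * (residue x n * d) = (residue x n * c) * d] (mod ?p ^ n)" by (simp add: ac_simps)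
    also have "[(residue x n * c) * d = d] (mod ?p ^ n)"
      using that(1) cong_scalar_right[of "residue x n * c" 1 "?p ^ n" d] by (simp add: cong_def)
    finally show ?thesis by (simp add: cong_def)
  qed
  define y where "y n = b n mod ?p ^ n" for n
  have "y n = y (Suc n) mod ?p ^ n" for n
  proof -
    have "(residue x n * b (Suc n)) mod ?p ^ n = (residue x (Suc n) * b (Suc n)) mod ?p ^ Suc n mod ?p ^ n"
      by (metis mod_power_Suc_mod mod_mult_left_eq residue_mod lessI less_imp_le)
    also have "\<dots> = 1 mod ?p ^ n" by (metis b mod_power_Suc_mod)
    finally show ?thesis using uniq[OF b] unfolding y_def by (metis mod_power_Suc_mod)
  qed
  then have yr: "residue (Abs_padic_int y :: 'p padic_int) = y"
    by (rule residue_Abs_padic_int)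
  have "x * Abs_padic_int y = 1"
    by (rule padic_int_eqI) (simp add: times_padic_int.rep_eq one_padic_int.rep_eq yr y_def mod_simps b)
  then show ?thesis by blast
qed

lemma padic_int_decomp:
  fixes x :: "'p::prime_card padic_int"
  assumes "x \<noteq> 0"
  obtains k u v where "x = of_nat CARD('p) ^ k * u" "u * v = 1"
proof -
  have "\<exists>m. residue x m \<noteq> 0" using assms padic_int_eqI[of x 0] by (auto simp: zero_padic_int.rep_eq)
  then obtain m where m: "residue x m \<noteq> 0" "\<And>j. j < m \<Longrightarrow> residue x j = 0"
    using exists_least_iff[of "\<lambda>m. residue x m \<noteq> 0"] by blast
  then obtain k where k: "m = Suc k" by (cases m) auto
  then obtain u where u: "x = of_nat CARD('p) ^ k * u" using m padic_int_dvd_power[of x k] by auto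
  have "residue u 1 \<noteq> 0"
  proof
    assume "residue u 1 = 0"
    then obtain w where "u = of_nat CARD('p) ^ 1 * w" using padic_int_dvd_power by blast
    then have "x = of_nat (CARD('p) ^ m) * w" using u k by simp
    then have "residue x m = 0" 
      by (simp add: times_padic_int.rep_eq residue_of_nat del: of_nat_power) simp
    then show False using m by simp
  qed
  then show ?thesis using padic_int_unit u that by blast
qed

lemma Zp_add: "x \<in> Zp \<Longrightarrow> y \<in> Zp \<Longrightarrow> x + y \<in> Zp"
  unfolding Zp_def by (auto simp: of_padic_int_add[symmetric])
lemma Zp_diff: "x \<in> Zp \<Longrightarrow> y \<in> Zp \<Longrightarrow> x - y \<in> Zp"
  unfolding Zp_def by (auto simp: of_padic_int_diff[symmetric])
lemma Zp_mult: "x \<in> Zp \<Longrightarrow> y \<in> Zp \<Longrightarrow> x * y \<in> Zp"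
  unfolding Zp_def by (auto simp: of_padic_int_mult[symmetric])
lemma Zp_uminus: "x \<in> Zp \<Longrightarrow> - x \<in> Zp"
  unfolding Zp_def by (auto simp: of_padic_int_minus[symmetric])
lemma Zp_0 [simp]: "0 \<in> Zp" unfolding Zp_def by (metis of_padic_int_0 rangeI)
lemma Zp_1 [simp]: "1 \<in> Zp" unfolding Zp_def by (metis of_padic_int_1 rangeI)
lemma Zp_of_nat [simp]: "of_nat n \<in> Zp" unfolding Zp_def by (metis of_padic_int_of_nat rangeI)
lemma Zp_power: "x \<in> Zp \<Longrightarrow> x ^ n \<in> Zp" by (induction n) (auto intro: Zp_mult)

lemma padic_cases_fraction:
  fixes x :: "'p::prime_card padic"
  obtains a b where "b \<noteq> 0" "x = of_padic_int a / of_padic_int b"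
proof -
  obtain a b where ab: "Rep_padic x = Fract a b" "b \<noteq> 0" by (cases "Rep_padic x") auto
  have "x = Abs_padic (Fract a b)" by (metis ab(1) Rep_padic_inverse)
  also have "\<dots> = of_padic_int a / of_padic_int b"
    unfolding of_padic_int_def divide_padic_def using ab by (simp add: Abs_padic_inverse)
  finally show ?thesis using that ab by blast
qed

lemma padic_decomp:
  fixes x :: "'p::prime_card padic"
  assumes "x \<noteq> 0"
  obtains k u where "x = of_nat CARD('p) powi k * u" "u \<in> Zp" "inverse u \<in> Zp" "u \<noteq> 0"
proof -
  obtain a b where ab: "b \<noteq> 0" "x = of_padic_int a / of_padic_int b" by (rule padic_cases_fraction)
  then have "a \<noteq> 0" using assms by auto
  then obtain k u v where a: "a = of_nat CARD('p) ^ k * u" "u * v = 1" by (rule padic_int_decomp)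
  obtain l s t where b: "b = of_nat CARD('p) ^ l * s" "s * t = 1" using padic_int_decomp ab(1) by blast
  have uv: "of_padic_int u * of_padic_int v = 1" "of_padic_int s * of_padic_int t = 1"
    using a(2) b(2) by (metis of_padic_int_mult of_padic_int_1)+
  then have nz: "of_padic_int u \<noteq> 0" "of_padic_int v \<noteq> 0" "of_padic_int s \<noteq> 0" "of_padic_int t \<noteq> 0" by auto
  have inv: "inverse (of_padic_int s) = of_padic_int t" "inverse (of_padic_int u) = of_padic_int v"
    "inverse (of_padic_int t) = of_padic_int s"
    using uv by (metis inverse_unique inverse_inverse_eq)+
  have "x = of_nat CARD('p) powi (int k - int l) * of_padic_int (u * t)"
    unfolding ab(2) a(1) b(1) using nz
    by (simp add: of_padic_int_mult of_padic_int_power divide_inverse inv power_int_diff)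
  moreover have "inverse (of_padic_int (u * t)) = of_padic_int (v * s)"
    by (simp add: of_padic_int_mult inv mult.commute)
  moreover have "inverse (of_padic_int (u * t)) \<in> Zp" "of_padic_int (u * t) \<in> Zp"
    unfolding calculation(2) by (auto simp: Zp_def)
  moreover have "of_padic_int (u * t) \<noteq> 0" using nz by (simp add: of_padic_int_mult)
  ultimately show ?thesis using that by blast
qed

lemma power_Zp_nonunit: "of_nat CARD('p) powi k \<in> (Zp :: 'p::prime_card padic set) \<longleftrightarrow> 0 \<le> k"
proof
  assume "0 \<le> k" then show "of_nat CARD('p) powi k \<in> (Zp :: 'p padic set)"
    by (simp add: power_int_def Zp_power)
next
  assume a: "of_nat CARD('p) powi k \<in> (Zp :: 'p padic set)"
  show "0 \<le> k"
  proof (rule ccontr)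
    assume "\<not> 0 \<le> k"
    then obtain m where m: "k = - int (Suc m)" by (metis negD not_le_imp_less)
    then have k: "of_nat CARD('p) powi k * of_nat CARD('p) ^ nat (- k - 1) * of_nat CARD('p) = (1::'p padic)"
    proof -
      have "nat (- k - 1) = m" using m by simp
      then show ?thesis unfolding m
        by (simp only: power_int_minus power_int_of_nat power_Suc) (simp add: field_simps)
    qed
    have "of_nat CARD('p) powi k * of_nat CARD('p) ^ nat (- k - 1) \<in> (Zp :: 'p padic set)"
      using a by (intro Zp_mult Zp_power) auto
    then obtain y where "of_nat CARD('p) powi k * of_nat CARD('p) ^ nat (- k - 1) = (of_padic_int y :: 'p padic)"
      unfolding Zp_def by auto
    with k have "of_padic_int (y * of_nat CARD('p)) = (of_padic_int 1 :: 'p padic)"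
      by (simp add: of_padic_int_mult)
    then have "y * of_nat CARD('p) = 1" by (simp only: of_padic_int_eq_iff)
    then have "residue (y * of_nat CARD('p)) 1 = residue (1 :: 'p padic_int) 1" by simp
    then show False using prime_card_gt_1_int[where 'p = 'p]
      by (simp add: times_padic_int.rep_eq residue_of_nat one_padic_int.rep_eq)
  qed
qed

text \<open>The largest \<open>k\<close> with \<open>x \<in> p\<^sup>k \<int>\<^sub>p\<close>. For \<open>x = 0\<close> (valuation \<open>\<infinity>\<close>) there is none and the value is
  junk, so that \<open>x \<noteq> 0\<close> has to be required separately.\<close>

definition padic_val :: "'p::prime_card padic \<Rightarrow> int" where
  "padic_val x = (GREATEST k. x / of_nat CARD('p) powi k \<in> Zp)"

lemma padic_val_eq:
  fixes u :: "'p::prime_card padic"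
  assumes u: "u \<in> Zp" "inverse u \<in> Zp" "u \<noteq> 0"
  shows "padic_val (of_nat CARD('p) powi k * u) = k"
proof -
  have "of_nat CARD('p) powi k * u / of_nat CARD('p) powi j \<in> Zp \<longleftrightarrow> j \<le> k" for j
  proof -
    have e: "of_nat CARD('p) powi k * u / of_nat CARD('p) powi j = of_nat CARD('p) powi (k - j) * u"
      by (simp add: power_int_diff)
    have "w * u \<in> Zp \<longleftrightarrow> w \<in> Zp" for w
    proof
      assume "w * u \<in> Zp"
      then have "w * u * inverse u \<in> Zp" using u Zp_mult by blast
      then show "w \<in> Zp" using u by (simp add: mult.assoc)
    qed (use u Zp_mult in blast)
    then show ?thesis unfolding e by (simp add: power_Zp_nonunit)
  qed
  then show ?thesis unfolding padic_val_def by (auto intro!: Greatest_equality)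
qed

text \<open>\<open>x \<equiv> y\<close> modulo \<open>m \<int>\<^sub>p\<close>\<close>

definition padic_cong :: "'p::prime_card padic \<Rightarrow> 'p padic \<Rightarrow> 'p padic \<Rightarrow> bool" where
  "padic_cong x y m \<longleftrightarrow> (\<exists>z\<in>Zp. x - y = m * z)"

text \<open>The \<open>p\<close>-adic topology: the sets \<open>x + p\<^sup>n \<int>\<^sub>p\<close> are a neighbourhood basis of \<open>x\<close>.\<close>

instantiation padic :: (prime_card) topological_space
begin

definition open_padic :: "'a padic set \<Rightarrow> bool" where
  "open_padic U \<longleftrightarrow> (\<forall>x\<in>U. \<exists>n. \<forall>y. padic_cong y x (of_nat CARD('a) ^ n) \<longrightarrow> y \<in> U)"

lemma padic_cong_mono:
  assumes "padic_cong x y (of_nat k ^ n)" "m \<le> n"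
  shows "padic_cong x y (of_nat k ^ m)"
proof -
  obtain z where "z \<in> Zp" "x - y = of_nat k ^ n * z" using assms by (auto simp: padic_cong_def)
  moreover have "of_nat k ^ n * z = of_nat k ^ m * (of_nat k ^ (n - m) * z)"
    using assms(2) by (simp add: mult.assoc[symmetric] flip: power_add)
  ultimately show ?thesis unfolding padic_cong_def by (metis Zp_mult Zp_power Zp_of_nat)
qed

instance
proof
  show "open (UNIV :: 'a padic set)" by (simp add: open_padic_def)
next
  fix S T :: "'a padic set"
  assume S: "open S" and T: "open T"
  show "open (S \<inter> T)" unfolding open_padic_def
  proof
    fix x assume "x \<in> S \<inter> T"
    then obtain m n where
      "\<And>y. padic_cong y x (of_nat CARD('a) ^ m) \<Longrightarrow> y \<in> S" "\<And>y. padic_cong y x (of_nat CARD('a) ^ n) \<Longrightarrow> y \<in> T"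
      using S T unfolding open_padic_def by blast
    then show "\<exists>n. \<forall>y. padic_cong y x (of_nat CARD('a) ^ n) \<longrightarrow> y \<in> S \<inter> T"
      by (intro exI[of _ "max m n"]) (auto dest: padic_cong_mono[of _ _ _ _ m] padic_cong_mono[of _ _ _ _ n])
  qed
next
  fix K :: "'a padic set set"
  assume "\<forall>S\<in>K. open S"
  then show "open (\<Union>K)" unfolding open_padic_def by (meson Union_iff)
qed

end

lemma padic_cong_refl [simp]: "padic_cong x x m"
  unfolding padic_cong_def by (intro bexI[of _ 0]) auto

lemma padic_cong_sym: "padic_cong x y m \<Longrightarrow> padic_cong y x m"
  unfolding padic_cong_def by (metis Zp_uminus minus_diff_eq mult_minus_right)

lemma padic_cong_trans: "padic_cong x y m \<Longrightarrow> padic_cong y z m \<Longrightarrow> padic_cong x z m"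
proof -
  assume "padic_cong x y m" "padic_cong y z m"
  then obtain a b where ab: "a \<in> Zp" "b \<in> Zp" "x - y = m * a" "y - z = m * b"
    by (auto simp: padic_cong_def)
  have "x - z = (x - y) + (y - z)" by simp
  also have "\<dots> = m * (a + b)" unfolding ab by (simp add: distrib_left)
  finally show ?thesis unfolding padic_cong_def using ab Zp_add by blast
qed

definition padic_coset :: "'p::prime_card padic \<Rightarrow> nat \<Rightarrow> 'p padic set" where
  "padic_coset c n = {x. padic_cong x c (of_nat CARD('p) ^ n)}"

lemma padic_coset_self [simp]: "c \<in> padic_coset c n" by (simp add: padic_coset_def)

lemma padic_coset_eq: "x \<in> padic_coset c n \<Longrightarrow> padic_coset x n = padic_coset c n"
  unfolding padic_coset_def by (auto intro: padic_cong_trans padic_cong_sym)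

lemma padic_coset_mono: "m \<le> n \<Longrightarrow> padic_coset c n \<subseteq> padic_coset c m"
  unfolding padic_coset_def by (auto intro: padic_cong_mono)

lemma padic_coset_translate: "a + x \<in> padic_coset c n \<longleftrightarrow> x \<in> padic_coset (c - a) n"
  unfolding padic_coset_def padic_cong_def by (simp add: algebra_simps)

lemma padic_coset_0: "padic_coset c 0 = {x. x - c \<in> Zp}"
  unfolding padic_coset_def padic_cong_def by auto

lemma open_padic_coset [simp]: "open (padic_coset c n)"
  unfolding open_padic_def padic_coset_def using padic_cong_trans by blast

lemma openE_padic_coset: "open U \<Longrightarrow> x \<in> U \<Longrightarrow> \<exists>n. padic_coset x n \<subseteq> U"
  unfolding open_padic_def padic_coset_def by blast

lemma of_padic_int_in_coset:
  "of_padic_int a \<in> padic_coset (of_padic_int b) n \<longleftrightarrow> residue a n = residue b n"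
proof
  assume "of_padic_int a \<in> padic_coset (of_padic_int b) n"
  then obtain y where "of_padic_int a - of_padic_int b = of_nat CARD('a) ^ n * of_padic_int y"
    unfolding padic_coset_def padic_cong_def Zp_def by auto
  then have "of_padic_int a = of_padic_int (b + of_nat (CARD('a) ^ n) * y)"
    by (simp add: of_padic_int_add of_padic_int_mult of_padic_int_power algebra_simps)
  then have "a = b + of_nat (CARD('a) ^ n) * y" by (simp only: of_padic_int_eq_iff)
  then show "residue a n = residue b n"
    by (simp add: plus_padic_int.rep_eq times_padic_int.rep_eq residue_of_nat del: of_nat_power) simp
next
  assume "residue a n = residue b n"
  then have "residue (a - b) n = 0" by (simp add: minus_padic_int.rep_eq)
  then obtain y where "a - b = of_nat CARD('a) ^ n * y" using padic_int_dvd_power by blast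
  then have "of_padic_int (a - b) = of_padic_int (of_nat (CARD('a) ^ n) * y)" by simp
  then have "of_padic_int a - of_padic_int b = of_nat CARD('a) ^ n * of_padic_int y"
    by (simp add: of_padic_int_diff of_padic_int_mult of_padic_int_power)
  then show "of_padic_int a \<in> padic_coset (of_padic_int b) n"
    unfolding padic_coset_def padic_cong_def Zp_def by auto
qed

lemma padic_int_approx:
  fixes a :: "'p::prime_card padic_int"
  shows "of_padic_int a \<in> padic_coset (of_nat (nat (residue a n))) n"
proof -
  have "residue (of_nat (nat (residue a n)) :: 'p padic_int) n = residue a n"
    unfolding residue_of_nat by (simp add: residue_bounds)
  then have "of_padic_int a \<in> padic_coset (of_padic_int (of_nat (nat (residue a n)))) n"
    by (simp only: of_padic_int_in_coset)
  then show ?thesis by simp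
qed

definition padic_frac :: "nat \<times> nat \<Rightarrow> 'p::prime_card padic" where
  "padic_frac q = of_nat (fst q) / of_nat CARD('p) ^ snd q"

lemma padic_frac_dense: "\<exists>q. padic_frac q \<in> padic_coset (x :: 'p::prime_card padic) n"
proof -
  have "\<exists>K. of_nat CARD('p) ^ K * x \<in> Zp"
  proof (cases "x = 0")
    case False
    then obtain k u where ku: "x = of_nat CARD('p) powi k * u" "u \<in> Zp" by (rule padic_decomp)
    have "of_nat CARD('p) ^ nat (- k) * x = of_nat CARD('p) powi (int (nat (- k)) + k) * u"
      by (simp add: ku(1) power_int_add flip: power_int_of_nat)
    also have "\<dots> \<in> Zp" by (intro Zp_mult ku) (simp add: power_Zp_nonunit)
    finally show ?thesis by blast
  qed auto
  then obtain K a where K: "of_nat CARD('p) ^ K * x = of_padic_int a" unfolding Zp_def by blast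
  obtain z where z: "z \<in> Zp" "of_padic_int a - of_nat (nat (residue a (n + K))) = of_nat CARD('p) ^ (n + K) * z"
    using padic_int_approx[of a "n + K"] by (auto simp: padic_coset_def padic_cong_def)
  have "x - padic_frac (nat (residue a (n + K)), K) = of_nat CARD('p) ^ n * z"
    using z(2) unfolding K[symmetric] padic_frac_def by (simp add: field_simps power_add)
  then have "x \<in> padic_coset (padic_frac (nat (residue a (n + K)), K)) n"
    using z(1) by (auto simp: padic_coset_def padic_cong_def)
  then show ?thesis using padic_coset_eq padic_coset_self by metis
qed

definition padic_cosets :: "'p::prime_card padic set set" where
  "padic_cosets = insert {} (range (\<lambda>(c, n). padic_coset c n))"

lemma padic_cosets_countable: "countable (padic_cosets :: 'p::prime_card padic set set)"
proof -
  have "padic_cosets \<subseteq> insert {} (range (\<lambda>(q, n). padic_coset (padic_frac q :: 'p padic) n))"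
  proof
    fix B :: "'p padic set" assume "B \<in> padic_cosets"
    then consider "B = {}" | c n where "B = padic_coset c n" by (auto simp: padic_cosets_def)
    then show "B \<in> insert {} (range (\<lambda>(q, n). padic_coset (padic_frac q) n))"
    proof cases
      case 2
      obtain q where "padic_frac q \<in> padic_coset c n" using padic_frac_dense by blast
      then have "B = (\<lambda>(q, n). padic_coset (padic_frac q) n) (q, n)" using 2 padic_coset_eq by auto
      then show ?thesis by blast
    qed simp
  qed
  then show ?thesis by (rule countable_subset) simp
qed

lemma sets_borel_padic: "sets (borel :: 'p::prime_card padic measure) = sigma_sets UNIV padic_cosets"
proof -
  have "sets (borel :: 'p padic measure) = sigma_sets UNIV {S. open S}" by (simp add: borel_def)
  also have "\<dots> = sigma_sets UNIV padic_cosets"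
  proof (rule sigma_sets_eqI)
    fix S :: "'p padic set" assume "S \<in> {S. open S}"
    then have S: "open S" by simp
    have "\<exists>B\<in>padic_cosets. x \<in> B \<and> B \<subseteq> S" if x: "x \<in> S" for x
    proof -
      obtain n where "padic_coset x n \<subseteq> S" using openE_padic_coset[OF S x] by blast
      moreover have "padic_coset x n \<in> padic_cosets" by (auto simp: padic_cosets_def)
      ultimately show ?thesis using padic_coset_self by blast
    qed
    then have "S = \<Union>{B \<in> padic_cosets. B \<subseteq> S}" by fast
    moreover have "countable {B \<in> padic_cosets. B \<subseteq> S}"
      by (rule countable_subset[OF _ padic_cosets_countable]) auto
    ultimately show "S \<in> sigma_sets UNIV padic_cosets"
      using sigma_sets_UNION[of "{B \<in> padic_cosets. B \<subseteq> S}" UNIV padic_cosets]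
      by (auto intro: sigma_sets.Basic)
  next
    fix B :: "'p padic set" assume "B \<in> padic_cosets"
    then show "B \<in> sigma_sets UNIV {S. open S}" by (auto simp: padic_cosets_def)
  qed
  finally show ?thesis .
qed

lemma padic_cosets_Int_stable: "Int_stable padic_cosets"
proof -
  have *: "padic_coset c m \<inter> padic_coset d n \<in> padic_cosets" if "m \<le> n" for c d :: "'a padic" and m n
  proof (cases "padic_coset c m \<inter> padic_coset d n = {}")
    case False
    then obtain x where x: "x \<in> padic_coset c m" "x \<in> padic_coset d n" by blast
    then have "padic_coset d n \<subseteq> padic_coset c m"
      using padic_coset_mono[OF that, of x] padic_coset_eq by metis
    then have "padic_coset c m \<inter> padic_coset d n = padic_coset d n" by blast
    then show ?thesis by (auto simp: padic_cosets_def)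
  qed (simp add: padic_cosets_def)
  show ?thesis
  proof (rule Int_stableI)
    fix A B :: "'a padic set" assume AB: "A \<in> padic_cosets" "B \<in> padic_cosets"
    show "A \<inter> B \<in> padic_cosets"
    proof (cases "A = {} \<or> B = {}")
      case True then show ?thesis by (auto simp: padic_cosets_def)
    next
      case False
      then obtain c m d n where "A = padic_coset c m" "B = padic_coset d n"
        using AB by (auto simp: padic_cosets_def)
      then show ?thesis using *[of m n c d] *[of n m d c] by (cases "m \<le> n") (auto simp: Int_commute)
    qed
  qed
qed

lemma padic_measure_eqI:
  fixes M N :: "'p::prime_card padic measure"
  assumes sets: "sets M = sets borel" "sets N = sets borel"
    and eq: "\<And>c n. emeasure M (padic_coset c n) = emeasure N (padic_coset c n)"
    and fin: "\<And>c. emeasure M (padic_coset c 0) \<noteq> \<infinity>"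
  shows "M = N"
proof -
  define A where "A = (\<lambda>i. padic_coset (padic_frac (from_nat i) :: 'p padic) 0)"
  show ?thesis
  proof (rule measure_eqI_generator_eq[where E = padic_cosets and \<Omega> = UNIV and A = A])
    show "(\<Union>i. A i) = UNIV"
    proof -
      have "x \<in> (\<Union>i. A i)" for x
      proof -
        obtain q where "padic_frac q \<in> padic_coset x 0" using padic_frac_dense by blast
        then have "x \<in> A (to_nat q)" unfolding A_def using padic_coset_eq[of "padic_frac q" x 0] by simp
        then show ?thesis by blast
      qed
      then show ?thesis by blast
    qed
  qed (use assms padic_cosets_Int_stable in \<open>auto simp: sets_borel_padic A_def padic_cosets_def\<close>)
qed

text \<open>Normalised Haar measures; existence and uniqueness are proved below.\<close>

definition padic_haar_measure :: "'p::prime_card padic measure \<Rightarrow> bool" where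
  "padic_haar_measure M \<longleftrightarrow>
    sets M = sets borel \<and> (\<forall>a. distr M borel ((+) a) = M) \<and> emeasure M Zp = 1"

text \<open>For existence, the Haar measure on \<open>\<int>\<^sub>p\<close> is the distribution of
  \<open>\<Sum>i. d\<^sub>i p\<^sup>i\<close> with independent uniform digits, and the one on \<open>\<rat>\<^sub>p\<close> is the sum of its
  translates over representatives of \<open>\<rat>\<^sub>p / \<int>\<^sub>p\<close>.\<close>

definition digits_to_padic_int :: "(nat \<Rightarrow> nat) \<Rightarrow> 'p::prime_card padic_int" where
  "digits_to_padic_int d = Abs_padic_int (\<lambda>n. (\<Sum>i<n. int (d i) * int CARD('p) ^ i) mod int CARD('p) ^ n)"

lemma residue_digits:
  "residue (digits_to_padic_int d :: 'p::prime_card padic_int) n =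
    (\<Sum>i<n. int (d i) * int CARD('p) ^ i) mod int CARD('p) ^ n"
proof -
  let ?f = "\<lambda>n. (\<Sum>i<n. int (d i) * int CARD('p) ^ i) mod int CARD('p) ^ n"
  have "residue (Abs_padic_int ?f :: 'p padic_int) = ?f"
  proof (rule residue_Abs_padic_int)
    fix n
    show "?f n = ?f (Suc n) mod int CARD('p) ^ n" unfolding mod_power_Suc_mod by simp
  qed
  then show ?thesis by (simp add: digits_to_padic_int_def)
qed

lemma digit_sum_less:
  fixes d :: "nat \<Rightarrow> nat"
  assumes "\<And>i. i < n \<Longrightarrow> d i < p"
  shows "(\<Sum>i<n. int (d i) * int p ^ i) < int p ^ n"
  using assms
proof (induction n)
  case (Suc n)
  have "int (d n) + 1 \<le> int p" using Suc.prems[of n] by simp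
  then have "(int (d n) + 1) * int p ^ n \<le> int p * int p ^ n" by (rule mult_right_mono) simp
  then show ?case using Suc by (simp add: algebra_simps)
qed simp

lemma residue_digits':
  assumes "\<And>i. d i < CARD('p)"
  shows "residue (digits_to_padic_int d :: 'p::prime_card padic_int) n = (\<Sum>i<n. int (d i) * int CARD('p) ^ i)"
  unfolding residue_digits by (rule mod_pos_pos_trivial) (auto intro: sum_nonneg digit_sum_less assms)

lemma digits_unique:
  fixes d e :: "nat \<Rightarrow> nat"
  assumes "\<And>i. d i < CARD('p)" "\<And>i. e i < CARD('p)"
  shows "residue (digits_to_padic_int d :: 'p::prime_card padic_int) n = residue (digits_to_padic_int e :: 'p padic_int) n
    \<longleftrightarrow> (\<forall>i<n. d i = e i)"
proof
  assume "residue (digits_to_padic_int d :: 'p padic_int) n = residue (digits_to_padic_int e :: 'p padic_int) n"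
  then show "\<forall>i<n. d i = e i"
  proof (induction n)
    case (Suc n)
    have eq: "residue (digits_to_padic_int d :: 'p padic_int) n = residue (digits_to_padic_int e :: 'p padic_int) n"
      using residue_mod[of n "Suc n" "digits_to_padic_int d :: 'p padic_int"]
        residue_mod[of n "Suc n" "digits_to_padic_int e :: 'p padic_int"] Suc.prems by simp
    then have "int (d n) * int CARD('p) ^ n = int (e n) * int CARD('p) ^ n"
      using Suc.prems unfolding residue_digits'[OF assms(1)] residue_digits'[OF assms(2)] by simp
    then have "d n = e n" by simp
    then show ?case using Suc.IH[OF eq] less_Suc_eq by auto
  qed simp
qed (simp add: residue_digits' assms)

lemma digits_exist: "\<exists>d. (\<forall>i. d i < CARD('p)) \<and> (a :: 'p::prime_card padic_int) = digits_to_padic_int d"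
proof -
  let ?p = "int CARD('p)"
  have p: "?p > 0" using prime_card_gt_1_int[where 'p = 'p] by simp
  define d where "d i = nat (residue a (Suc i) div ?p ^ i)" for i
  have d: "int (d i) = residue a (Suc i) div ?p ^ i" for i
    using residue_bounds[of a "Suc i"] p by (simp add: d_def pos_imp_zdiv_nonneg_iff)
  have lt: "d i < CARD('p)" for i
  proof -
    have "residue a (Suc i) < ?p * ?p ^ i" using residue_bounds(2)[of a "Suc i"] by simp
    moreover have "residue a (Suc i) div ?p ^ i * ?p ^ i \<le> residue a (Suc i)"
      using p by (simp flip: minus_mod_eq_div_mult)
    ultimately have "residue a (Suc i) div ?p ^ i * ?p ^ i < ?p * ?p ^ i" by linarith
    then have "residue a (Suc i) div ?p ^ i < ?p" using p by (simp only: mult_less_cancel_right) simp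
    then show ?thesis unfolding d[symmetric] by simp
  qed
  have "residue a n = (\<Sum>i<n. int (d i) * ?p ^ i)" for n
  proof (induction n)
    case (Suc n)
    have "residue a (Suc n) = residue a (Suc n) mod ?p ^ n + residue a (Suc n) div ?p ^ n * ?p ^ n"
      by (rule mod_div_mult_eq[symmetric])
    also have "residue a (Suc n) mod ?p ^ n = residue a n" by (simp add: residue_mod)
    finally show ?case using Suc d by simp
  qed simp
  then have "a = digits_to_padic_int d" by (intro padic_int_eqI) (simp add: residue_digits' lt)
  with lt show ?thesis by blast
qed

definition padic_digit_measure :: "'p::prime_card itself \<Rightarrow> (nat \<Rightarrow> nat) measure" where
  "padic_digit_measure _ = PiM UNIV (\<lambda>_. uniform_count_measure {..<CARD('p)})"

definition padic_int_measure :: "'p::prime_card padic measure" where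
  "padic_int_measure = distr (padic_digit_measure TYPE('p)) borel (\<lambda>d. of_padic_int (digits_to_padic_int d))"

lemma Zp_coset_empty:
  assumes "c \<notin> Zp" shows "padic_coset c n \<inter> Zp = {}"
proof -
  have "x \<notin> Zp" if "x \<in> padic_coset c n" for x
  proof
    assume "x \<in> Zp"
    moreover have "c - x \<in> Zp" using that padic_coset_mono[of 0 n c] Zp_uminus[of "x - c"]
      by (auto simp: padic_coset_0)
    ultimately have "x + (c - x) \<in> Zp" by (rule Zp_add)
    then show False using assms by simp
  qed
  then show ?thesis by blast
qed

lemma padic_digit_measure_coset:
  fixes c :: "'p::prime_card padic"
  defines "f \<equiv> \<lambda>d. of_padic_int (digits_to_padic_int d) :: 'p padic"
  shows "f -` padic_coset c n \<inter> space (padic_digit_measure TYPE('p)) \<in> sets (padic_digit_measure TYPE('p))" (is ?A)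
    and "emeasure (padic_digit_measure TYPE('p)) (f -` padic_coset c n \<inter> space (padic_digit_measure TYPE('p))) =
      (if c \<in> Zp then ennreal (1 / real CARD('p) ^ n) else 0)" (is ?B)
proof -
  have p: "0 < CARD('p)" using prime_card_gt_1_int[where 'p = 'p] by linarith
  interpret product_prob_space "\<lambda>_ :: nat. uniform_count_measure {..<CARD('p)}" UNIV
    by (intro product_prob_spaceI prob_space_uniform_count_measure) (use p in \<open>auto simp: lessThan_def intro!: exI[of _ 0]\<close>)
  have sp: "space (padic_digit_measure TYPE('p)) = {d. \<forall>i. d i < CARD('p)}"
    by (auto simp: padic_digit_measure_def space_PiM space_uniform_count_measure PiE_def Pi_def)
  have "?A \<and> ?B"
  proof (cases "c \<in> Zp")
    case False
    then have "f -` padic_coset c n \<inter> space (padic_digit_measure TYPE('p)) = {}"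
      using Zp_coset_empty[OF False, of n] by (auto simp: f_def Zp_def)
    then show ?thesis using False by simp
  next
    case True
    then obtain e where e: "\<And>i. e i < CARD('p)" "c = of_padic_int (digits_to_padic_int e)"
      unfolding Zp_def using digits_exist by (metis imageE)
    have eq: "f -` padic_coset c n \<inter> space (padic_digit_measure TYPE('p)) =
        {d \<in> space (padic_digit_measure TYPE('p)). \<forall>i\<in>{..<n}. d i \<in> {e i}}"
      unfolding sp f_def e(2) by (auto simp: of_padic_int_in_coset digits_unique e(1))
    have "emeasure (padic_digit_measure TYPE('p)) (f -` padic_coset c n \<inter> space (padic_digit_measure TYPE('p))) =
        (\<Prod>i<n. emeasure (uniform_count_measure {..<CARD('p)}) {e i})"
      unfolding eq unfolding padic_digit_measure_def
      by (rule emeasure_PiM_Collect) (auto simp: sets_uniform_count_measure e(1))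
    also have "\<dots> = (\<Prod>i<n. ennreal (1 / real CARD('p)))"
      by (intro prod.cong refl) (simp add: emeasure_uniform_count_measure e(1))
    also have "\<dots> = ennreal (1 / real CARD('p) ^ n)"
      using p by (simp add: ennreal_power power_one_over)
    finally have B: "emeasure (padic_digit_measure TYPE('p)) (f -` padic_coset c n \<inter> space (padic_digit_measure TYPE('p)))
      = ennreal (1 / real CARD('p) ^ n)" .
    then have ?A using p by (intro emeasure_neq_0_sets) simp
    then show ?thesis using B True by simp
  qed
  then show ?A ?B by blast+
qed

lemma measurable_digits:
  "(\<lambda>d. of_padic_int (digits_to_padic_int d) :: 'p::prime_card padic) \<in> padic_digit_measure TYPE('p) \<rightarrow>\<^sub>M borel"
  by (rule measurable_sigma_sets[OF sets_borel_padic])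
    (auto simp: padic_cosets_def padic_digit_measure_coset(1))

lemma emeasure_padic_int_measure:
  "emeasure padic_int_measure (padic_coset (c :: 'p::prime_card padic) n) =
    (if c \<in> Zp then ennreal (1 / real CARD('p) ^ n) else 0)"
  unfolding padic_int_measure_def
  by (subst emeasure_distr[OF measurable_digits]) (simp_all add: padic_digit_measure_coset(2))

lemma padic_int_measure_prob: "prob_space (padic_int_measure :: 'p::prime_card padic measure)"
proof -
  have p: "0 < CARD('p)" using prime_card_gt_1_int[where 'p = 'p] by linarith
  interpret product_prob_space "\<lambda>_ :: nat. uniform_count_measure {..<CARD('p)}" UNIV
    by (intro product_prob_spaceI prob_space_uniform_count_measure) (use p in \<open>auto simp: lessThan_def intro!: exI[of _ 0]\<close>)
  show ?thesis unfolding padic_int_measure_def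
    by (rule prob_space.prob_space_distr[OF _ measurable_digits])
      (simp add: padic_digit_measure_def P.prob_space_axioms)
qed

definition padic_rep :: "'p::prime_card padic \<Rightarrow> 'p padic" where
  "padic_rep x = padic_frac (SOME q. padic_frac q \<in> padic_coset x 0)"

lemma padic_rep: "padic_rep x \<in> padic_coset x 0"
  unfolding padic_rep_def by (rule someI_ex) (rule padic_frac_dense)

lemma padic_rep_cong: "x \<in> padic_coset y 0 \<Longrightarrow> padic_rep x = padic_rep y"
  unfolding padic_rep_def by (simp add: padic_coset_eq)

lemma countable_padic_reps: "countable (range padic_rep)"
  by (rule countable_subset[of _ "range padic_frac"]) (auto simp: padic_rep_def)

lemma padic_reps_unique:
  assumes "r \<in> range padic_rep"
  shows "c - r \<in> Zp \<longleftrightarrow> r = padic_rep c"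
proof
  assume "r = padic_rep c"
  then show "c - r \<in> Zp" using padic_rep[of c] Zp_uminus[of "r - c"] by (auto simp: padic_coset_0)
next
  assume "c - r \<in> Zp"
  then have c: "c \<in> padic_coset r 0" by (simp add: padic_coset_0)
  obtain x where x: "r = padic_rep x" using assms by blast
  then have "r \<in> padic_coset x 0" using padic_rep by simp
  then have "c \<in> padic_coset x 0" using c padic_coset_eq by blast
  then show "r = padic_rep c" using x padic_rep_cong by metis
qed

lemma measurable_padic_plus: "(+) a \<in> (borel :: 'p::prime_card padic measure) \<rightarrow>\<^sub>M borel"
proof (rule measurable_sigma_sets[OF sets_borel_padic])
  fix B :: "'p padic set" assume "B \<in> padic_cosets"
  then consider "B = {}" | c n where "B = padic_coset c n" by (auto simp: padic_cosets_def)
  then show "(+) a -` B \<inter> space borel \<in> sets borel"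
  proof cases
    case 2
    then have "(+) a -` B = padic_coset (c - a) n" by (auto simp: padic_coset_translate)
    then show ?thesis by simp
  qed simp
qed auto

theorem padic_haar_measure_coset:
  fixes M :: "'p::prime_card padic measure"
  assumes "padic_haar_measure M"
  shows "emeasure M (padic_coset c n) = ennreal (1 / real CARD('p) ^ n)"
proof -
  have p: "0 < CARD('p)" using prime_card_gt_1_int[where 'p = 'p] by linarith
  have sets: "sets M = sets borel" and inv: "\<And>a. distr M borel ((+) a) = M" and 1: "emeasure M Zp = 1"
    using assms by (auto simp: padic_haar_measure_def)
  have shift: "emeasure M (padic_coset c n) = emeasure M (padic_coset 0 n)" for c
  proof -
    have "emeasure M (padic_coset c n) = emeasure (distr M borel ((+) c)) (padic_coset c n)" by (simp only: inv)
    also have "\<dots> = emeasure M ((+) c -` padic_coset c n \<inter> space M)"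
      by (rule emeasure_distr) (use measurable_padic_plus sets in \<open>auto cong: measurable_cong_sets\<close>)
    also have "(+) c -` padic_coset c n \<inter> space M = padic_coset 0 n"
      using sets_eq_imp_space_eq[OF sets] by (auto simp: padic_coset_translate)
    finally show ?thesis .
  qed
  have disj: "disjoint_family_on (\<lambda>i. padic_coset (of_nat i :: 'p padic) n) {..<CARD('p) ^ n}"
    unfolding disjoint_family_on_def
  proof (intro ballI impI)
    fix i j assume ij: "i \<in> {..<CARD('p) ^ n}" "j \<in> {..<CARD('p) ^ n}" "i \<noteq> j"
    show "padic_coset (of_nat i :: 'p padic) n \<inter> padic_coset (of_nat j) n = {}"
    proof (rule ccontr)
      assume "padic_coset (of_nat i :: 'p padic) n \<inter> padic_coset (of_nat j) n \<noteq> {}"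
      then obtain x :: "'p padic" where "x \<in> padic_coset (of_nat i) n" "x \<in> padic_coset (of_nat j) n" by blast
      then have "padic_coset (of_nat i :: 'p padic) n = padic_coset (of_nat j) n" using padic_coset_eq by metis
      then have "of_padic_int (of_nat i :: 'p padic_int) \<in> padic_coset (of_padic_int (of_nat j)) n"
        using padic_coset_self[of "of_nat i :: 'p padic" n] by simp
      then have "residue (of_nat i :: 'p padic_int) n = residue (of_nat j :: 'p padic_int) n"
        by (simp only: of_padic_int_in_coset)
      then have "int i mod int CARD('p) ^ n = int j mod int CARD('p) ^ n" by (simp only: residue_of_nat)
      then have "int (i mod CARD('p) ^ n) = int (j mod CARD('p) ^ n)" by (simp only: zmod_int of_nat_power)
      then show False using ij by simp
    qed
  qed
  have Zp: "Zp = (\<Union>i\<in>{..<CARD('p) ^ n}. padic_coset (of_nat i :: 'p padic) n)"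
  proof (intro equalityI subsetI)
    fix x :: "'p padic" assume "x \<in> Zp"
    then obtain a where a: "x = of_padic_int a" by (auto simp: Zp_def)
    have "int (nat (residue a n)) < int (CARD('p) ^ n)" using residue_bounds[of a n] by simp
    then have "nat (residue a n) \<in> {..<CARD('p) ^ n}" by (simp only: of_nat_less_iff lessThan_iff)
    then show "x \<in> (\<Union>i\<in>{..<CARD('p) ^ n}. padic_coset (of_nat i) n)" using padic_int_approx[of a n] a by blast
  next
    fix x :: "'p padic" assume "x \<in> (\<Union>i\<in>{..<CARD('p) ^ n}. padic_coset (of_nat i) n)"
    then obtain i where "x \<in> padic_coset (of_nat i) 0" using padic_coset_mono[of 0 n] by blast
    then have "(x - of_nat i) + of_nat i \<in> Zp" unfolding padic_coset_0 by (intro Zp_add) auto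
    then show "x \<in> Zp" by simp
  qed
  have "1 = emeasure M (\<Union>i\<in>{..<CARD('p) ^ n}. padic_coset (of_nat i :: 'p padic) n)" using 1 Zp by simp
  also have "\<dots> = (\<Sum>i<CARD('p) ^ n. emeasure M (padic_coset (of_nat i :: 'p padic) n))"
    by (rule sum_emeasure[OF _ disj, symmetric]) (simp_all add: sets image_subset_iff)
  also have "\<dots> = of_nat (CARD('p) ^ n) * emeasure M (padic_coset 0 n)"
    by (subst sum.cong[OF refl shift]) (simp only: sum_constant card_lessThan)
  finally have e: "ennreal (real (CARD('p) ^ n)) * emeasure M (padic_coset 0 n) = 1"
    by (simp only: ennreal_of_nat_eq_real_of_nat)
  have "ennreal (1 / real CARD('p) ^ n) * ennreal (real (CARD('p) ^ n)) = 1"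
    using p by (simp flip: ennreal_mult)
  then have "emeasure M (padic_coset 0 n) = ennreal (1 / real CARD('p) ^ n)"
    using e by (metis mult.assoc mult.right_neutral mult_1)
  with shift[of c] show ?thesis by (rule trans)
qed

theorem padic_haar_measure_exists: "\<exists>M :: 'p::prime_card padic measure. padic_haar_measure M"
proof -
  have p: "0 < CARD('p)" using prime_card_gt_1_int[where 'p = 'p] by linarith
  let ?R = "count_space (range padic_rep) :: 'p padic measure"
  let ?N = "padic_int_measure :: 'p padic measure"
  define M where "M = distr (?R \<Otimes>\<^sub>M ?N) borel (\<lambda>(r, z). r + z)"
  have N: "sets ?N = sets borel" by (simp add: padic_int_measure_def)
  interpret N: prob_space ?N by (rule padic_int_measure_prob)
  have meas: "(\<lambda>(r, z). r + z) \<in> ?R \<Otimes>\<^sub>M ?N \<rightarrow>\<^sub>M borel"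
  proof (rule measurable_pair_measure_countable1[OF countable_padic_reps])
    fix r :: "'p padic"
    have "(+) r \<in> ?N \<rightarrow>\<^sub>M borel" using measurable_padic_plus measurable_cong_sets[OF N refl] by blast
    then show "(\<lambda>y. case (r, y) of (r, z) \<Rightarrow> r + z) \<in> ?N \<rightarrow>\<^sub>M borel" by (simp add: fun_eq_iff)
  qed
  have coset: "emeasure M (padic_coset c n) = ennreal (1 / real CARD('p) ^ n)" for c n
  proof -
    have sp: "space (?R \<Otimes>\<^sub>M ?N) = range padic_rep \<times> UNIV"
      using sets_eq_imp_space_eq[OF N] by (simp add: space_pair_measure)
    have "emeasure M (padic_coset c n) = emeasure (?R \<Otimes>\<^sub>M ?N) ((\<lambda>(r, z). r + z) -` padic_coset c n \<inter> space (?R \<Otimes>\<^sub>M ?N))"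
      unfolding M_def by (rule emeasure_distr[OF meas]) simp
    also have "\<dots> = (\<integral>\<^sup>+ r. emeasure ?N (Pair r -` ((\<lambda>(r, z). r + z) -` padic_coset c n \<inter> space (?R \<Otimes>\<^sub>M ?N))) \<partial>?R)"
      by (rule N.emeasure_pair_measure_alt) (rule measurable_sets[OF meas], simp)
    also have "\<dots> = (\<integral>\<^sup>+ r. ennreal (1 / real CARD('p) ^ n) * indicator {padic_rep c} r \<partial>?R)"
    proof (rule nn_integral_cong)
      fix r assume "r \<in> space ?R"
      then have r: "r \<in> range padic_rep" by simp
      have "Pair r -` ((\<lambda>(r, z). r + z) -` padic_coset c n \<inter> space (?R \<Otimes>\<^sub>M ?N)) = padic_coset (c - r) n"
        unfolding sp using r by (auto simp: padic_coset_translate)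
      then show "emeasure ?N (Pair r -` ((\<lambda>(r, z). r + z) -` padic_coset c n \<inter> space (?R \<Otimes>\<^sub>M ?N))) =
          ennreal (1 / real CARD('p) ^ n) * indicator {padic_rep c} r"
        using padic_reps_unique[OF r, of c] by (simp add: emeasure_padic_int_measure indicator_def)
    qed
    also have "\<dots> = ennreal (1 / real CARD('p) ^ n)"
      by (subst nn_integral_cmult_indicator) auto
    finally show ?thesis .
  qed
  have "padic_haar_measure M" unfolding padic_haar_measure_def
  proof (intro conjI allI)
    show sM: "sets M = sets borel" by (simp add: M_def)
    have spM: "space M = UNIV" using sets_eq_imp_space_eq[OF sM] by simp
    have "Zp = padic_coset (0 :: 'p padic) 0" by (simp add: padic_coset_0)
    then show "emeasure M Zp = 1" using coset[of 0 0] by simp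
    fix a :: "'p padic"
    have plus: "(+) a \<in> M \<rightarrow>\<^sub>M borel" using measurable_padic_plus measurable_cong_sets[OF sM refl] by blast
    have "emeasure (distr M borel ((+) a)) (padic_coset c n) = ennreal (1 / real CARD('p) ^ n)" for c n
    proof -
      have "(+) a -` padic_coset c n \<inter> space M = padic_coset (c - a) n"
        using spM by (auto simp: padic_coset_translate)
      then show ?thesis by (subst emeasure_distr[OF plus]) (simp_all add: coset)
    qed
    then show "distr M borel ((+) a) = M"
      by (intro padic_measure_eqI) (simp_all add: sM coset)
  qed
  then show ?thesis by blast
qed

theorem padic_haar_measure_unique:
  assumes "padic_haar_measure M" "padic_haar_measure N"
  shows "M = N"
  by (rule padic_measure_eqI)
    (use assms in \<open>simp_all add: padic_haar_measure_coset\<close>, simp_all add: padic_haar_measure_def)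

definition padic_haar :: "'p::prime_card padic measure" where
  "padic_haar = (THE M. padic_haar_measure M)"

lemma padic_haar_measure_padic_haar: "padic_haar_measure padic_haar"
proof -
  obtain M :: "'a padic measure" where M: "padic_haar_measure M" using padic_haar_measure_exists ..
  show ?thesis unfolding padic_haar_def
    by (rule theI[of padic_haar_measure, OF M]) (rule padic_haar_measure_unique[OF _ M])
qed

definition hilbert_symbol :: "'a::field \<Rightarrow> 'a \<Rightarrow> int" where
  "hilbert_symbol a b =
    (if \<exists>x y z. (x, y, z) \<noteq> (0, 0, 0) \<and> z\<^sup>2 = a * x\<^sup>2 + b * y\<^sup>2 then 1 else -1)"

definition padic_symbol :: "'p::prime_card padic \<Rightarrow> 'p padic \<Rightarrow> int" where
  "padic_symbol t1 t2 =
    (if t1 = 0 \<or> t2 = 0 then 0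
     else if odd CARD('p) \<and> even (padic_val t1) \<and> even (padic_val t2) then 0
     else if CARD('p) = 2 \<and> even (padic_val t1) \<and> even (padic_val t2) \<and>
       \<not> padic_cong (t1 / 2 powi padic_val t1) (t2 / 2 powi padic_val t2) 4 then 0
     else hilbert_symbol t1 t2)"

end

theory Submission
  imports Defs "HOL-Number_Theory.Euler_Criterion"
begin

text \<open>Multiplying \<open>t\<^sub>1\<close> and \<open>t\<^sub>2\<close> by fixed units preserves both the domain of integration and the Haar
  measure, so it suffices to find units for which this multiplication changes the sign of the symbol;
  if \<open>p\<close> is odd and both valuations are even, the symbol vanishes identically.

  If \<open>t\<^sub>2\<close> has odd valuation, multiply \<open>t\<^sub>1\<close> by a unit \<open>g\<close> with \<open>(g, t\<^sub>2) = -1\<close>: a quadratic non-residue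
  for odd \<open>p\<close>, and \<open>5\<close> for \<open>p = 2\<close>. Then \<open>(g t\<^sub>1, t\<^sub>2) = -(t\<^sub>1, t\<^sub>2)\<close>, an instance of the bilinearity of the
  Hilbert symbol that has a direct proof (\<open>hilbert_symbol_unit_twist\<close>). Being a norm from \<open>\<rat>\<^sub>p(\<surd>t\<^sub>2)\<close> is a multiplicative condition, so \<open>t\<^sub>1\<close> and
  \<open>g t\<^sub>1\<close> are not both norms; and \<open>(a, b) = (-a b, b)\<close> reduces the claim that one of them is to the case
  of a unit \<open>t\<^sub>1\<close>, where it can be checked modulo \<open>p\<close> or modulo \<open>8\<close>. The case of odd \<open>v(t\<^sub>1)\<close> is
  symmetric. If \<open>p = 2\<close> and both valuations are even, \<open>(t\<^sub>1, t\<^sub>2) \<mapsto> (-t\<^sub>1, -t\<^sub>2)\<close> changes the sign, because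
  the symbol of two congruent units is \<open>1\<close> or \<open>-1\<close> according to their common class modulo \<open>4\<close>
  (\<open>padic_symbol_minus_dyadic\<close>).

  The integral is then the difference of the measures of the sets where the symbol is \<open>1\<close> and \<open>-1\<close>,
  which are equal (\<open>padic_symbol_level_balanced\<close>). These sets are measurable because the symbol is
  locally constant: elements congruent to \<open>1\<close> modulo \<open>4 p\<close> are squares (\<open>padic_int_sqrt\<close>).\<close>

section \<open>Square roots of \<open>p\<close>-adic integers\<close>

lemma residue_eq_0_iff_dvd:
  fixes x :: "'p::prime_card padic_int"
  shows "residue x n = 0 \<longleftrightarrow> of_nat CARD('p) ^ n dvd x"
proof
  assume "of_nat CARD('p) ^ n dvd x"
  then obtain y where "x = of_nat (CARD('p) ^ n) * y" by auto
  then show "residue x n = 0"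
    by (simp add: times_padic_int.rep_eq residue_of_nat del: of_nat_power) simp
qed (use padic_int_dvd_power in \<open>auto simp: dvd_def\<close>)

lemma residue_eq_iff_dvd:
  fixes x y :: "'p::prime_card padic_int"
  shows "residue x n = residue y n \<longleftrightarrow> of_nat CARD('p) ^ n dvd x - y"
proof -
  have "residue (x - y) n = 0 \<longleftrightarrow> int CARD('p) ^ n dvd residue x n - residue y n"
    by (simp add: minus_padic_int.rep_eq mod_eq_0_iff_dvd)
  also have "\<dots> \<longleftrightarrow> residue x n mod int CARD('p) ^ n = residue y n mod int CARD('p) ^ n"
    by (simp only: mod_eq_dvd_iff)
  also have "\<dots> \<longleftrightarrow> residue x n = residue y n" by simp
  finally show ?thesis by (simp only: residue_eq_0_iff_dvd)
qed

text \<open>Hensel's lemma for \<open>r\<^sup>2 + r - p m\<close>, whose derivative is \<open>1\<close> at the approximate root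
  \<open>0\<close>: the map \<open>r \<mapsto> p m - r\<^sup>2\<close> contracts the multiples of \<open>p\<close>, so its iterates converge to a fixed
  point. This form of the equation treats \<open>p = 2\<close> and odd \<open>p\<close> alike.\<close>
lemma padic_int_quadratic_root:
  fixes m :: "'p::prime_card padic_int"
  shows "\<exists>r. r\<^sup>2 + r = of_nat CARD('p) * m"
proof -
  let ?p = "of_nat CARD('p) :: 'p padic_int"
  define s where "s = rec_nat 0 (\<lambda>_ r. ?p * m - r\<^sup>2)"
  have s0: "s 0 = 0" and s: "s (Suc n) = ?p * m - (s n)\<^sup>2" for n by (simp_all add: s_def)
  have div: "?p dvd s n" for n by (induction n) (simp_all add: s0 s power2_eq_square)
  have step: "?p ^ Suc n dvd s (Suc n) - s n" for n
  proof (induction n)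
    case (Suc n)
    have "s (Suc (Suc n)) - s (Suc n) = - ((s (Suc n) - s n) * (s (Suc n) + s n))"
      unfolding s[of "Suc n"] s[of n] by (simp add: algebra_simps power2_eq_square)
    moreover have "?p ^ Suc n * ?p dvd (s (Suc n) - s n) * (s (Suc n) + s n)"
      by (intro mult_dvd_mono Suc.IH dvd_add div)
    ultimately show ?case by (simp add: mult.commute)
  qed (use div in \<open>simp add: s0\<close>)
  have eq: "residue (s (Suc n)) n = residue (s n) n" for n
    using step[of n] unfolding residue_eq_iff_dvd by (metis dvd_mult_right power_Suc)
  \<comment> \<open>The limit of the iterates: modulo \<open>p\<^sup>n\<close> they are constant from \<open>s n\<close> onwards.\<close>
  define r where "r = (Abs_padic_int (\<lambda>n. residue (s n) n) :: 'p padic_int)"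
  have r: "residue r = (\<lambda>n. residue (s n) n)"
    unfolding r_def by (rule residue_Abs_padic_int) (simp add: residue_mod eq)
  have "r\<^sup>2 + r = ?p * m"
  proof (rule padic_int_eqI)
    fix n
    have "residue (r\<^sup>2 + r) n = residue ((s n)\<^sup>2 + s n) n"
      by (simp add: padic_int_ops_rep_eq power2_eq_square r)
    also have "\<dots> = residue ((s n)\<^sup>2 + s (Suc n)) n"
      using eq[of n] by (simp add: plus_padic_int.rep_eq)
    finally show "residue (r\<^sup>2 + r) n = residue (?p * m) n" by (simp add: s)
  qed
  then show ?thesis ..
qed

text \<open>Completing the square in the previous equation, \<open>(1 + 2 r)\<^sup>2 = 1 + 4 (r\<^sup>2 + r)\<close>. For odd \<open>p\<close> the
  factor \<open>4\<close> is a unit, and for \<open>p = 2\<close> this says that units congruent to \<open>1\<close> modulo \<open>8\<close> are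
  squares.\<close>
lemma padic_int_sqrt:
  fixes m :: "'p::prime_card padic_int"
  shows "\<exists>s. s\<^sup>2 = 1 + 4 * (of_nat CARD('p) * m)"
proof -
  obtain r where "r\<^sup>2 + r = of_nat CARD('p) * m" using padic_int_quadratic_root by blast
  moreover have "(1 + 2 * r)\<^sup>2 = 1 + 4 * (r\<^sup>2 + r)" by (simp add: power2_eq_square algebra_simps)
  ultimately have "(1 + 2 * r)\<^sup>2 = 1 + 4 * (of_nat CARD('p) * m)" by simp
  then show ?thesis ..
qed

lemma padic_int_unit_iff:
  fixes u :: "'p::prime_card padic_int"
  shows "residue u 1 \<noteq> 0 \<longleftrightarrow> u dvd 1"
proof
  assume "u dvd 1"
  then have "\<not> of_nat CARD('p) dvd u"
    using residue_eq_0_iff_dvd[of "1::'p padic_int" 1] prime_card_gt_1_int[where 'p = 'p] 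
    by (auto simp: one_padic_int.rep_eq dest: dvd_trans)
  then show "residue u 1 \<noteq> 0" by (simp add: residue_eq_0_iff_dvd)
qed (metis padic_int_unit dvdI)

section \<open>Rational points on the conic \<open>z\<^sup>2 = a x\<^sup>2 + b y\<^sup>2\<close>\<close>

definition conic_has_point :: "'a::field \<Rightarrow> 'a \<Rightarrow> bool" where
  "conic_has_point a b \<longleftrightarrow> (\<exists>x y z. (x, y, z) \<noteq> (0, 0, 0) \<and> z\<^sup>2 = a * x\<^sup>2 + b * y\<^sup>2)"

lemma hilbert_symbol_conic: "hilbert_symbol a b = (if conic_has_point a b then 1 else -1)"
  by (simp add: hilbert_symbol_def conic_has_point_def)

lemma conic_commute: "conic_has_point a b \<longleftrightarrow> conic_has_point b a"
  unfolding conic_has_point_def by (metis add.commute prod.inject)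

lemma conic_of_square: "conic_has_point (s\<^sup>2) b"
  unfolding conic_has_point_def by (rule exI[of _ 1], rule exI[of _ 0], rule exI[of _ s]) simp

lemma conic_mult_square:
  fixes a b c :: "'a::field"
  assumes "c \<noteq> 0"
  shows "conic_has_point (a * c\<^sup>2) b \<longleftrightarrow> conic_has_point a b"
proof -
  have *: "conic_has_point (a * c\<^sup>2) b \<Longrightarrow> conic_has_point a b" if "c \<noteq> 0" for a b c :: 'a
  proof -
    assume "conic_has_point (a * c\<^sup>2) b"
    then obtain x y z where "(x, y, z) \<noteq> (0, 0, 0)" "z\<^sup>2 = a * c\<^sup>2 * x\<^sup>2 + b * y\<^sup>2"
      by (auto simp: conic_has_point_def)
    then have "(c * x, y, z) \<noteq> (0, 0, 0)" "z\<^sup>2 = a * (c * x)\<^sup>2 + b * y\<^sup>2"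
      using that by (auto simp: power_mult_distrib mult.assoc)
    then show "conic_has_point a b" unfolding conic_has_point_def by blast
  qed
  have "a * c\<^sup>2 * (inverse c)\<^sup>2 = a" using assms by (simp add: field_simps)
  then show ?thesis using *[OF assms, of a b] *[of "inverse c" "a * c\<^sup>2" b] assms by (metis nonzero_imp_inverse_nonzero)
qed

text \<open>The instance \<open>(-b, b) = 1\<close> of bilinearity, made explicit: \<open>(x, y, z) \<mapsto> (x, z, b y)\<close> carries
  points of one conic to points of the other. It trades \<open>a\<close> for an element whose valuation has the
  other parity when \<open>b\<close> has odd valuation.\<close>
lemma conic_neg_mult:
  fixes a b :: "'a::field"
  assumes "b \<noteq> 0"
  shows "conic_has_point (- a * b) b \<longleftrightarrow> conic_has_point a b"
proof -
  have *: "conic_has_point (- a * b) b" if ab: "conic_has_point a b" for a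
  proof -
    obtain x y z where "(x, y, z) \<noteq> (0, 0, 0)" "z\<^sup>2 = a * x\<^sup>2 + b * y\<^sup>2"
      using ab by (auto simp: conic_has_point_def)
    then have "(x, z, b * y) \<noteq> (0, 0, 0)" "(b * y)\<^sup>2 = - a * b * x\<^sup>2 + b * z\<^sup>2"
      using assms by (auto simp: algebra_simps power2_eq_square)
    then show ?thesis unfolding conic_has_point_def by blast
  qed
  have "- (- a * b) * b = a * b\<^sup>2" by (simp add: power2_eq_square algebra_simps)
  then show ?thesis using *[of a] *[of "- a * b"] conic_mult_square[OF assms, of a b] by metis
qed

text \<open>When \<open>b\<close> is not a square, the conic has a point exactly if \<open>a\<close> is a norm from the field obtained
  by adjoining \<open>\<surd>b\<close>, and norms form a group. Multiplying the two norms \<open>z\<^sup>2 - b y\<^sup>2 = a x\<^sup>2\<close> and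
  \<open>z'\<^sup>2 - b y'\<^sup>2 = g a x'\<^sup>2\<close> gives a point for \<open>g\<close>. Points with \<open>x = 0\<close> or \<open>x' = 0\<close> occur only for
  square \<open>b\<close>, when the conic has a point for every \<open>g\<close>.\<close>
lemma conic_quotient:
  fixes a b g :: "'a::field"
  assumes "a \<noteq> 0" and "conic_has_point a b" "conic_has_point (g * a) b"
  shows "conic_has_point g b"
proof -
  obtain x y z where 1: "(x, y, z) \<noteq> (0, 0, 0)" "z\<^sup>2 = a * x\<^sup>2 + b * y\<^sup>2"
    using assms(2) by (auto simp: conic_has_point_def)
  obtain x' y' z' where 2: "(x', y', z') \<noteq> (0, 0, 0)" "z'\<^sup>2 = g * a * x'\<^sup>2 + b * y'\<^sup>2"
    using assms(3) by (auto simp: conic_has_point_def)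
  have sq: "conic_has_point g b" if "w\<^sup>2 = b * v\<^sup>2" "v \<noteq> 0" for v w
  proof -
    have "(w / v)\<^sup>2 = b" using that by (simp add: power_divide)
    then show ?thesis using conic_of_square conic_commute by metis
  qed
  show ?thesis
  proof (cases "x = 0 \<or> x' = 0")
    case True
    then show ?thesis using 1 2 sq by (cases "x = 0") fastforce+
  next
    case False
    have "(z * z' + b * y * y')\<^sup>2 - b * (z * y' + z' * y)\<^sup>2 = (z\<^sup>2 - b * y\<^sup>2) * (z'\<^sup>2 - b * y'\<^sup>2)"
      by (simp add: power2_eq_square algebra_simps)
    also have "\<dots> = g * (a * x * x')\<^sup>2" unfolding 1(2) 2(2) by (simp add: power2_eq_square algebra_simps)
    finally have "(z * z' + b * y * y')\<^sup>2 = g * (a * x * x')\<^sup>2 + b * (z * y' + z' * y)\<^sup>2"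
      by (simp add: algebra_simps)
    moreover have "a * x * x' \<noteq> 0" using False assms(1) by simp
    ultimately show ?thesis unfolding conic_has_point_def by blast
  qed
qed

lemma padic_denominator: "\<exists>K. of_nat CARD('p) ^ K * (x :: 'p::prime_card padic) \<in> Zp"
proof -
  obtain q where "x - padic_frac q \<in> Zp" using padic_frac_dense[of x 0] padic_coset_0
    by (metis mem_Collect_eq padic_coset_eq padic_coset_self)
  then have "of_nat CARD('p) ^ snd q * (x - padic_frac q) + of_nat (fst q) \<in> Zp"
    by (intro Zp_add Zp_mult Zp_power) auto
  moreover have "of_nat CARD('p) ^ snd q * (x - padic_frac q) + of_nat (fst q) = of_nat CARD('p) ^ snd q * x"
    by (simp add: padic_frac_def algebra_simps)
  ultimately show ?thesis by metis
qed

text \<open>Clear denominators, then divide out common factors \<open>p\<close>. The descent is by induction on a level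
  modulo which the solution does not vanish.\<close>
lemma conic_primitive_solution:
  fixes A B :: "'p::prime_card padic_int"
  assumes "conic_has_point (of_padic_int A) (of_padic_int B)"
  obtains X Y Z where "Z\<^sup>2 = A * X\<^sup>2 + B * Y\<^sup>2" "residue X 1 \<noteq> 0 \<or> residue Y 1 \<noteq> 0 \<or> residue Z 1 \<noteq> 0"
proof -
  let ?p = "of_nat CARD('p) :: 'p padic_int"
  obtain x y z where xyz: "(x, y, z) \<noteq> (0, 0, 0)" "z\<^sup>2 = of_padic_int A * x\<^sup>2 + of_padic_int B * y\<^sup>2"
    using assms by (auto simp: conic_has_point_def)
  obtain i j k where "of_nat CARD('p) ^ i * x \<in> Zp" "of_nat CARD('p) ^ j * y \<in> Zp" "of_nat CARD('p) ^ k * z \<in> Zp"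
    using padic_denominator by meson
  then have "of_nat CARD('p) ^ (j + k) * (of_nat CARD('p) ^ i * x) \<in> Zp"
    "of_nat CARD('p) ^ (i + k) * (of_nat CARD('p) ^ j * y) \<in> Zp"
    "of_nat CARD('p) ^ (i + j) * (of_nat CARD('p) ^ k * z) \<in> Zp"
    by (blast intro: Zp_mult Zp_power Zp_of_nat)+
  then obtain X Y Z where
    "of_padic_int X = of_nat CARD('p) ^ (j + k) * (of_nat CARD('p) ^ i * x)"
    "of_padic_int Y = of_nat CARD('p) ^ (i + k) * (of_nat CARD('p) ^ j * y)"
    "of_padic_int Z = of_nat CARD('p) ^ (i + j) * (of_nat CARD('p) ^ k * z)"
    by (auto simp: Zp_def)
  then have XYZ:
    "of_padic_int X = of_nat CARD('p) ^ (i + j + k) * x"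
    "of_padic_int Y = of_nat CARD('p) ^ (i + j + k) * y"
    "of_padic_int Z = of_nat CARD('p) ^ (i + j + k) * z"
    by (simp_all add: power_add ac_simps)
  have "of_padic_int (Z\<^sup>2) = of_padic_int (A * X\<^sup>2 + B * Y\<^sup>2)"
    by (simp add: of_padic_int_add of_padic_int_mult of_padic_int_power XYZ power_mult_distrib xyz(2) algebra_simps)
  then have eq: "Z\<^sup>2 = A * X\<^sup>2 + B * Y\<^sup>2" by (simp only: of_padic_int_eq_iff)
  have "X \<noteq> 0 \<or> Y \<noteq> 0 \<or> Z \<noteq> 0"
    using xyz(1) XYZ by (metis mult_eq_0_iff of_nat_prime_padic_nonzero of_padic_int_0 power_not_zero)
  then obtain n where "residue X n \<noteq> 0 \<or> residue Y n \<noteq> 0 \<or> residue Z n \<noteq> 0"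
    by (metis padic_int_eqI zero_padic_int.rep_eq)
  with eq show ?thesis
  proof (induction n arbitrary: X Y Z)
    case (Suc n)
    show ?case
    proof (cases "residue X 1 \<noteq> 0 \<or> residue Y 1 \<noteq> 0 \<or> residue Z 1 \<noteq> 0")
      case True
      then show ?thesis using that Suc.prems(1) by blast
    next
      case False
      then obtain X' Y' Z' where d: "X = ?p * X'" "Y = ?p * Y'" "Z = ?p * Z'"
        by (auto simp: residue_eq_0_iff_dvd elim!: dvdE)
      have "?p\<^sup>2 * Z'\<^sup>2 = ?p\<^sup>2 * (A * X'\<^sup>2 + B * Y'\<^sup>2)"
        using Suc.prems(1) unfolding d by (simp add: power_mult_distrib algebra_simps)
      then have "Z'\<^sup>2 = A * X'\<^sup>2 + B * Y'\<^sup>2" by simp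
      moreover have "residue X' n \<noteq> 0 \<or> residue Y' n \<noteq> 0 \<or> residue Z' n \<noteq> 0"
        using Suc.prems(2) unfolding d residue_eq_0_iff_dvd by auto
      ultimately show ?thesis by (rule Suc.IH)
    qed
  qed simp
qed

section \<open>Units that twist norms to non-norms\<close>

lemma residue_mult_1_eq_0_iff:
  fixes x y :: "'p::prime_card padic_int"
  shows "residue (x * y) 1 = 0 \<longleftrightarrow> residue x 1 = 0 \<or> residue y 1 = 0"
proof -
  have "residue (x * y) 1 = 0 \<longleftrightarrow> int CARD('p) dvd residue x 1 * residue y 1"
    by (simp add: times_padic_int.rep_eq mod_eq_0_iff_dvd)
  also have "\<dots> \<longleftrightarrow> int CARD('p) dvd residue x 1 \<or> int CARD('p) dvd residue y 1"
    by (rule prime_dvd_mult_iff[OF prime_card_int])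
  finally show ?thesis using residue_mod_self[of x 1] residue_mod_self[of y 1] by (simp add: mod_eq_0_iff_dvd[symmetric])
qed

lemma residue_1_eq_0_iff:
  fixes x :: "'p::prime_card padic_int"
  assumes "0 < n"
  shows "residue x 1 = 0 \<longleftrightarrow> int CARD('p) dvd residue x n"
  using residue_mod[of 1 n x] assms by (simp add: mod_eq_0_iff_dvd[symmetric])

text \<open>Squaring on \<open>\<int>/p\<close> identifies \<open>1\<close> with \<open>-1\<close>, so it is not surjective.\<close>
lemma exists_quadratic_nonresidue:
  assumes "prime p" "odd (p :: nat)"
  shows "\<exists>g. \<not> QuadRes (int p) g"
proof -
  let ?f = "\<lambda>x. x\<^sup>2 mod int p"
  have p: "2 < int p" using prime_gt_1_nat[OF assms(1)] assms(2) by (cases "p = 2") auto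
  have "(int p - 1)\<^sup>2 = 1 + int p * (int p - 2)" by (simp add: power2_eq_square algebra_simps)
  then have "?f (int p - 1) = 1 mod int p" by (metis mod_mult_self2)
  then have "?f (int p - 1) = ?f 1" by simp
  then have "\<not> inj_on ?f {0..<int p}" using p inj_onD[of ?f "{0..<int p}" "int p - 1" 1] by auto
  moreover have "?f ` {0..<int p} \<subseteq> {0..<int p}" using p by auto
  ultimately have "?f ` {0..<int p} \<noteq> {0..<int p}" using eq_card_imp_inj_on[of "{0..<int p}" ?f] by auto
  then obtain g where g: "g \<in> {0..<int p}" "g \<notin> ?f ` {0..<int p}" using \<open>?f ` {0..<int p} \<subseteq> {0..<int p}\<close> by blast
  have "\<not> QuadRes (int p) g"
  proof
    assume "QuadRes (int p) g"
    then obtain y where "y\<^sup>2 mod int p = g mod int p" by (auto simp: QuadRes_def cong_def)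
    then have "g = ?f (y mod int p)" using g(1) by (simp add: power_mod)
    moreover have "y mod int p \<in> {0..<int p}" using p by simp
    ultimately have "g \<in> ?f ` {0..<int p}" by (rule image_eqI)
    with g(2) show False by contradiction
  qed
  then show ?thesis ..
qed

text \<open>By Euler's criterion both factors have \<open>(p - 1)/2\<close>-th power \<open>-1\<close>.\<close>
lemma QuadRes_nonresidue_mult:
  assumes p: "prime p" "odd (p :: nat)" and "\<not> QuadRes (int p) g" "\<not> QuadRes (int p) u"
  shows "QuadRes (int p) (g * u)"
proof (rule ccontr)
  assume gu: "\<not> QuadRes (int p) (g * u)"
  have p2: "2 < p" using prime_gt_1_nat[OF p(1)] p(2) by (cases "p = 2") auto
  let ?k = "(p - 1) div 2"
  have L: "[-1 = a ^ ?k] (mod int p)" if "\<not> QuadRes (int p) a" for a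
  proof -
    have "\<not> [a = 0] (mod int p)"
    proof
      assume "[a = 0] (mod int p)"
      then have "[0\<^sup>2 = a] (mod int p)" by (simp add: cong_sym_eq)
      then show False using that unfolding QuadRes_def by blast
    qed
    then have "Legendre a (int p) = -1" using that by (simp add: Legendre_def)
    then show ?thesis using euler_criterion[OF p(1) p2, of a] by simp
  qed
  have "[(-1) * (-1) = g ^ ?k * u ^ ?k] (mod int p)" by (intro cong_mult L assms)
  moreover have "[-1 = g ^ ?k * u ^ ?k] (mod int p)" using L[OF gu] by (simp add: power_mult_distrib)
  ultimately have "[1 = -1] (mod int p)" using cong_trans cong_sym by fastforce
  then have "int p dvd 2" by (simp add: cong_iff_dvd_diff)
  then show False using p2 zdvd_imp_le by fastforce
qed

text \<open>If \<open>u\<close> is congruent to \<open>s\<^sup>2\<close> modulo \<open>p\<close>, then \<open>u / s\<^sup>2\<close> has the form \<open>1 + 4 p m\<close>, as \<open>4\<close> is a unit for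
  odd \<open>p\<close>.\<close>
lemma padic_int_square_of_QuadRes:
  fixes u :: "'p::prime_card padic_int"
  assumes odd: "odd CARD('p)" and u: "residue u 1 \<noteq> 0" and "QuadRes (int CARD('p)) (residue u 1)"
  shows "\<exists>s. u = s\<^sup>2"
proof -
  let ?p = "int CARD('p)"
  have p: "0 < ?p" using prime_card_gt_1_int[where 'p = 'p] by simp
  obtain y where y: "[y\<^sup>2 = residue u 1] (mod ?p)" using assms(3) by (auto simp: QuadRes_def)
  define s where "s = (of_nat (nat (y mod ?p)) :: 'p padic_int)"
  have s1: "residue s 1 = y mod ?p" unfolding s_def residue_of_nat using p by simp
  have us: "residue u 1 = residue (s\<^sup>2) 1"
    using y residue_mod_self[of u 1] unfolding cong_def power2_eq_square times_padic_int.rep_eq s1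
    by (simp add: mod_simps)
  then have "residue s 1 \<noteq> 0" using u by (metis power2_eq_square residue_mult_1_eq_0_iff)
  then obtain t where t: "s * t = 1" using padic_int_unit by blast
  have "residue (of_nat 4 :: 'p padic_int) 1 \<noteq> 0"
  proof
    assume "residue (of_nat 4 :: 'p padic_int) 1 = 0"
    then have "?p dvd int 4" unfolding residue_of_nat mod_eq_0_iff_dvd by simp
    then have "?p dvd 2 * 2" by simp
    then have "?p dvd 2" using prime_dvd_mult_iff[OF prime_card_int] by blast
    then have "?p \<le> 2" by (rule zdvd_imp_le) simp
    then have "?p = 2" using prime_card_gt_1_int[where 'p = 'p] by linarith
    then show False using odd by simp
  qed
  then obtain w where w: "4 * w = (1 :: 'p padic_int)" using padic_int_unit by fastforce
  obtain m where m: "u - s\<^sup>2 = of_nat CARD('p) * m"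
    using us by (auto simp: residue_eq_iff_dvd elim: dvdE)
  obtain r where r: "r\<^sup>2 = 1 + 4 * (of_nat CARD('p) * (w * m * t\<^sup>2))" using padic_int_sqrt by blast
  have "(s * r)\<^sup>2 = s\<^sup>2 + (4 * w) * (s * t)\<^sup>2 * (of_nat CARD('p) * m)"
    by (simp add: power_mult_distrib r algebra_simps)
  then have "u = (s * r)\<^sup>2" by (simp add: w t flip: m)
  then show ?thesis ..
qed

lemma dyadic_int_square:
  fixes u :: "'p::prime_card padic_int"
  assumes "CARD('p) = 2" "residue u 3 = 1"
  shows "\<exists>s. u = s\<^sup>2"
proof -
  have "residue u 3 = residue (1 :: 'p padic_int) 3" using assms by (simp add: one_padic_int.rep_eq)
  then obtain m where "u - 1 = 2 ^ 3 * m" by (auto simp: residue_eq_iff_dvd assms(1) elim: dvdE)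
  then have "u = 1 + 4 * (of_nat CARD('p) * m)" by (simp add: assms(1) algebra_simps)
  then show ?thesis using padic_int_sqrt by metis
qed

lemma conic_of_padic_int:
  assumes "A * X\<^sup>2 + B * Y\<^sup>2 = Z\<^sup>2" "X \<noteq> 0"
  shows "conic_has_point (of_padic_int A) (of_padic_int B)"
proof -
  have "(of_padic_int Z)\<^sup>2 = of_padic_int A * (of_padic_int X)\<^sup>2 + of_padic_int B * (of_padic_int Y)\<^sup>2"
    by (simp flip: assms(1) of_padic_int_power of_padic_int_mult of_padic_int_add)
  moreover have "of_padic_int X \<noteq> 0" using assms(2) by (metis of_padic_int_0 of_padic_int_eq_iff)
  ultimately show ?thesis unfolding conic_has_point_def by blast
qed

lemma int_square_mod_8: "odd x \<Longrightarrow> x\<^sup>2 mod 8 = 1" "even x \<Longrightarrow> x\<^sup>2 mod 8 \<in> {0, 4}" for x :: int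
proof -
  have "x mod 8 \<in> {0..<8}" by simp
  then have "x mod 8 \<in> {0,1,2,3,4,5,6,7}" by (auto simp: atLeastLessThan_iff)
  moreover have "x\<^sup>2 mod 8 = (x mod 8)\<^sup>2 mod 8" by (simp add: power_mod)
  moreover have "even x \<longleftrightarrow> even (x mod 8)" by presburger
  ultimately show "odd x \<Longrightarrow> x\<^sup>2 mod 8 = 1" "even x \<Longrightarrow> x\<^sup>2 mod 8 \<in> {0, 4}" by auto
qed
text \<open>If \<open>x\<close> and \<open>z\<close> are odd, then \<open>z\<^sup>2 - 5 x\<^sup>2\<close> is \<open>4\<close> modulo \<open>8\<close>, whereas the \<open>2\<close>-adic valuation of
  \<open>2 v y\<^sup>2\<close> is odd. If they are even, then \<open>4\<close> divides \<open>2 v y\<^sup>2\<close>, so \<open>y\<close> is even.\<close>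
lemma dyadic_no_primitive_solution:
  fixes x y z v :: int
  assumes eq: "z\<^sup>2 mod 8 = (5 * x\<^sup>2 + 2 * (v * y\<^sup>2)) mod 8" and v: "odd v"
  shows "even x \<and> even y \<and> even z"
proof -
  have zx: "z\<^sup>2 mod 8 = (5 * (x\<^sup>2 mod 8) + 2 * (v * y\<^sup>2)) mod 8"
    unfolding eq by (intro mod_add_cong) (simp_all add: mod_mult_right_eq)
  have parity: "even z \<longleftrightarrow> even x"
  proof -
    have "even (z\<^sup>2 mod 8) \<longleftrightarrow> even (5 * (x\<^sup>2 mod 8) + 2 * (v * y\<^sup>2))" unfolding zx by presburger
    moreover have "even (z\<^sup>2 mod 8) \<longleftrightarrow> even (z\<^sup>2)" "even (x\<^sup>2 mod 8) \<longleftrightarrow> even (x\<^sup>2)" by (simp_all add: dvd_mod_iff)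
    ultimately show ?thesis by simp
  qed
  have even_key: "even w" if ac: "a \<in> {0, 4}" "c \<in> {0, 4}" and eq: "c = (5 * a + 2 * w) mod 8" for a c w :: int
  proof -
    obtain a' c' where "a = 4 * a'" "c = 4 * c'" using ac by (metis dvdE dvd_0_right dvd_refl insertE singletonD)
    moreover obtain q where "5 * a + 2 * w = c + 8 * q"
      unfolding eq by (metis mod_mult_div_eq)
    ultimately have "w = 2 * (c' - 5 * a' + 2 * q)" by presburger
    then show ?thesis by (rule dvdI)
  qed
  have odd_key: "w mod 4 = 2 \<and> even w" if "1 = (5 * 1 + 2 * w) mod 8" for w :: int
    using that by presburger
  show ?thesis
  proof (cases "even x")
    case True
    have "x\<^sup>2 mod 8 \<in> {0, 4}" "z\<^sup>2 mod 8 \<in> {0, 4}" using True parity int_square_mod_8 by auto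
    then have "even (v * y\<^sup>2)" using zx by (rule even_key)
    then show ?thesis using True parity v by simp
  next
    case False
    have "x\<^sup>2 mod 8 = 1" "z\<^sup>2 mod 8 = 1" using False parity int_square_mod_8 by auto
    then have c: "v * y\<^sup>2 mod 4 = 2" "even (v * y\<^sup>2)" using zx odd_key by metis+
    then have "even y" using v by simp
    then obtain w where "y = 2 * w" by blast
    then have "v * y\<^sup>2 mod 4 = 0" by (simp add: power2_eq_square)
    then show ?thesis using c by simp
  qed
qed

text \<open>Modulo \<open>8\<close>, the odd values of \<open>z\<^sup>2 - 2 v y\<^sup>2\<close> with odd \<open>z\<close> include \<open>1\<close> and \<open>1 - 2 v\<close>, that is \<open>{1, 7}\<close> or
  \<open>{1, 3}\<close>; in both cases the multiples by \<open>5\<close> are the two remaining odd classes.\<close>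
lemma dyadic_twist_represents:
  fixes u v :: int
  assumes "odd u" "odd v"
  shows "u mod 8 = 1 \<or> (u + 2 * v) mod 8 = 1 \<or> 5 * u mod 8 = 1 \<or> (5 * u + 2 * v) mod 8 = 1"
proof -
  have key: "a = 1 \<or> (a + b) mod 8 = 1 \<or> 5 * a mod 8 = 1 \<or> (5 * a + b) mod 8 = 1"
    if "a = 1 \<or> a = 3 \<or> a = 5 \<or> a = 7" "b = 2 \<or> b = 6" for a b :: int
    using that by auto
  have u: "u mod 8 = 1 \<or> u mod 8 = 3 \<or> u mod 8 = 5 \<or> u mod 8 = 7" using assms(1) by presburger
  have v: "2 * v mod 8 = 2 \<or> 2 * v mod 8 = 6" using assms(2) by presburger
  have 5: "5 * u mod 8 = 5 * (u mod 8) mod 8" by (rule mod_mult_right_eq[symmetric])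
  have "(u + 2 * v) mod 8 = (u mod 8 + 2 * v mod 8) mod 8" by (rule mod_add_eq[symmetric])
  moreover have "(5 * u + 2 * v) mod 8 = (5 * (u mod 8) + 2 * v mod 8) mod 8"
    by (intro mod_add_cong 5) simp
  ultimately show ?thesis unfolding 5 using key[OF u v] by (simp only:)
qed

text \<open>The unit \<open>g\<close> is not a norm from \<open>\<rat>\<^sub>p(\<surd>(p v))\<close> for any unit \<open>v\<close>, but the unit norms and their
  multiples by \<open>1/g\<close> exhaust all units. Together these say that the unit norms have
  index \<open>2\<close> among the units.\<close>
definition norm_twist :: "'p::prime_card padic_int \<Rightarrow> bool" where
  "norm_twist g \<longleftrightarrow> residue g 1 \<noteq> 0 \<and>
    (\<forall>v. residue v 1 \<noteq> 0 \<longrightarrow> \<not> conic_has_point (of_padic_int g) (of_padic_int (of_nat CARD('p) * v))) \<and>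
    (\<forall>u v. residue u 1 \<noteq> 0 \<longrightarrow> residue v 1 \<noteq> 0 \<longrightarrow>
      conic_has_point (of_padic_int u) (of_padic_int (of_nat CARD('p) * v)) \<or>
      conic_has_point (of_padic_int (g * u)) (of_padic_int (of_nat CARD('p) * v)))"

text \<open>A quadratic non-residue works: \<open>u\<close> or \<open>g u\<close> is a square. In a primitive point of
  \<open>z\<^sup>2 = g x\<^sup>2 + p v y\<^sup>2\<close>, reduction modulo \<open>p\<close> forces \<open>p\<close> to divide \<open>x\<close> and \<open>z\<close>, and then \<open>p\<^sup>2\<close> divides
  \<open>p v y\<^sup>2\<close>, so \<open>p\<close> divides \<open>y\<close> as well.\<close>
lemma norm_twist_odd:
  assumes odd: "odd CARD('p::prime_card)"
  shows "\<exists>g :: 'p padic_int. norm_twist g"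
proof -
  let ?p = "int CARD('p)"
  have p: "0 < ?p" using prime_card_gt_1_int[where 'p = 'p] by simp
  have prime: "prime CARD('p)" using prime_card_int[where 'a = 'p] by simp
  obtain k where k: "\<not> QuadRes ?p k" using exists_quadratic_nonresidue[OF prime odd] by blast
  define g where "g = (of_nat (nat (k mod ?p)) :: 'p padic_int)"
  have g1: "residue g 1 = k mod ?p" unfolding g_def residue_of_nat using p by simp
  have QR_mod: "QuadRes ?p (a mod ?p) \<longleftrightarrow> QuadRes ?p a" for a by (simp add: QuadRes_def cong_def)
  have ng: "\<not> QuadRes ?p (residue g 1)" using k unfolding g1 QR_mod .
  have "residue g 1 \<noteq> 0"
  proof
    assume "residue g 1 = 0"
    then have "[0\<^sup>2 = residue g 1] (mod ?p)" by simp
    then show False using ng unfolding QuadRes_def by blast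
  qed
  moreover have "\<not> conic_has_point (of_padic_int g) (of_padic_int (of_nat CARD('p) * v))"
    if v: "residue v 1 \<noteq> 0" for v
  proof
    assume "conic_has_point (of_padic_int g) (of_padic_int (of_nat CARD('p) * v))"
    then obtain X Y Z where eq: "Z\<^sup>2 = g * X\<^sup>2 + of_nat CARD('p) * v * Y\<^sup>2"
      and prim: "residue X 1 \<noteq> 0 \<or> residue Y 1 \<noteq> 0 \<or> residue Z 1 \<noteq> 0"
      by (rule conic_primitive_solution)
    have "Z\<^sup>2 - g * X\<^sup>2 = of_nat CARD('p) ^ 1 * (v * Y\<^sup>2)" using eq by simp
    then have res: "residue (Z\<^sup>2) 1 = residue (g * X\<^sup>2) 1" unfolding residue_eq_iff_dvd by (metis dvd_triv_left)
    have X: "residue X 1 = 0"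
    proof (rule ccontr)
      assume "residue X 1 \<noteq> 0"
      then obtain W where W: "X * W = 1" using padic_int_unit by blast
      have "residue ((Z * W)\<^sup>2) 1 = residue (Z\<^sup>2 * W\<^sup>2) 1" by (simp add: power_mult_distrib)
      also have "\<dots> = residue (g * X\<^sup>2 * W\<^sup>2) 1"
        using res by (simp add: times_padic_int.rep_eq[of "Z\<^sup>2"] times_padic_int.rep_eq[of "g * X\<^sup>2"])
      also have "g * X\<^sup>2 * W\<^sup>2 = g * (X * W)\<^sup>2" by (simp add: power_mult_distrib)
      finally have "residue ((Z * W)\<^sup>2) 1 = residue g 1" by (simp add: W)
      moreover have "residue ((Z * W)\<^sup>2) 1 = (residue (Z * W) 1)\<^sup>2 mod ?p"
        unfolding power2_eq_square times_padic_int.rep_eq[of "Z * W" "Z * W"] by simp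
      ultimately have "[(residue (Z * W) 1)\<^sup>2 = residue g 1] (mod ?p)"
        unfolding cong_def using residue_mod_self[of g 1] by simp
      then show False using ng unfolding QuadRes_def by blast
    qed
    then have Z: "residue Z 1 = 0" using res by (metis power2_eq_square residue_mult_1_eq_0_iff)
    obtain X' Z' where d: "X = of_nat CARD('p) * X'" "Z = of_nat CARD('p) * Z'"
      using X Z by (auto simp: residue_eq_0_iff_dvd elim!: dvdE)
    have "of_nat CARD('p) * (of_nat CARD('p) * (Z'\<^sup>2 - g * X'\<^sup>2)) = of_nat CARD('p) * (v * Y\<^sup>2)"
      using eq unfolding d by (simp add: algebra_simps power2_eq_square)
    then have "of_nat CARD('p) ^ 1 * (Z'\<^sup>2 - g * X'\<^sup>2) = v * Y\<^sup>2" by simp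
    then have "residue (v * Y\<^sup>2) 1 = 0" unfolding residue_eq_0_iff_dvd by (metis dvd_triv_left)
    then show False using v X Z prim by (simp only: power2_eq_square residue_mult_1_eq_0_iff) simp
  qed
  moreover have "conic_has_point (of_padic_int u) (of_padic_int b) \<or> conic_has_point (of_padic_int (g * u)) (of_padic_int b)"
    if u: "residue u 1 \<noteq> 0" for u b
  proof -
    have sq: ?thesis if "u = s\<^sup>2 \<or> g * u = s\<^sup>2" for s
      using that conic_of_square[of "of_padic_int s" "of_padic_int b"] by (auto simp: of_padic_int_power)
    have "QuadRes ?p (residue (g * u) 1) \<longleftrightarrow> QuadRes ?p (residue g 1 * residue u 1)"
      by (simp add: times_padic_int.rep_eq QR_mod)
    then have "QuadRes ?p (residue u 1) \<or> QuadRes ?p (residue (g * u) 1)"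
      using QuadRes_nonresidue_mult[OF prime odd ng, of "residue u 1"] by blast
    then have "(\<exists>s. u = s\<^sup>2) \<or> (\<exists>s. g * u = s\<^sup>2)"
      using padic_int_square_of_QuadRes[OF odd] u calculation(1) residue_mult_1_eq_0_iff by metis
    then show ?thesis using sq by blast
  qed
  ultimately show ?thesis unfolding norm_twist_def by blast
qed

text \<open>Here \<open>5\<close> works, by the two preceding computations modulo \<open>8\<close>: they decide which units are norms
  because a unit congruent to \<open>1\<close> modulo \<open>8\<close> is a square.\<close>
lemma norm_twist_dyadic:
  assumes 2: "CARD('p::prime_card) = 2"
  shows "\<exists>g :: 'p padic_int. norm_twist g"
proof -
  let ?two = "of_nat CARD('p) :: 'p padic_int"
  let ?g = "of_nat 5 :: 'p padic_int"
  have odd_iff: "residue u 1 \<noteq> 0 \<longleftrightarrow> odd (residue u 3)" for u :: "'p padic_int"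
    using residue_1_eq_0_iff[of 3 u] 2 by simp
  have r2: "residue ?two 3 = 2" and r5: "residue ?g 3 = 5" unfolding residue_of_nat by (simp_all add: 2)
  have "residue ?g 1 \<noteq> 0" by (simp only: odd_iff r5) simp
  moreover have "\<not> conic_has_point (of_padic_int ?g) (of_padic_int (?two * v))"
    if v: "residue v 1 \<noteq> 0" for v
  proof
    assume "conic_has_point (of_padic_int ?g) (of_padic_int (?two * v))"
    then obtain X Y Z where eq: "Z\<^sup>2 = ?g * X\<^sup>2 + ?two * v * Y\<^sup>2"
      and prim: "residue X 1 \<noteq> 0 \<or> residue Y 1 \<noteq> 0 \<or> residue Z 1 \<noteq> 0"
      by (rule conic_primitive_solution)
    have "residue (Z\<^sup>2) 3 = residue (?g * X\<^sup>2 + ?two * v * Y\<^sup>2) 3" by (simp only: eq)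
    then have "(residue Z 3)\<^sup>2 mod 8 = (5 * (residue X 3)\<^sup>2 + 2 * (residue v 3 * (residue Y 3)\<^sup>2)) mod 8"
      by (simp only: padic_int_ops_rep_eq r2 r5 power2_eq_square) (simp add: 2 mod_simps mult.assoc)
    then show False
      using dyadic_no_primitive_solution[of "residue Z 3" "residue X 3" "residue v 3" "residue Y 3"] v prim
      by (simp only: odd_iff) blast
  qed
  moreover have "conic_has_point (of_padic_int u) (of_padic_int (?two * v)) \<or>
      conic_has_point (of_padic_int (?g * u)) (of_padic_int (?two * v))"
    if u: "residue u 1 \<noteq> 0" and v: "residue v 1 \<noteq> 0" for u v
  proof -
    have sq: "conic_has_point (of_padic_int w) (of_padic_int (?two * v))"
      if "residue w 3 = 1 \<or> residue (w + ?two * v) 3 = 1" for w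
      using that
    proof
      assume "residue w 3 = 1"
      then obtain s where "w = s\<^sup>2" using dyadic_int_square[OF 2] by blast
      then show ?thesis by (simp only: of_padic_int_power conic_of_square)
    next
      assume "residue (w + ?two * v) 3 = 1"
      then obtain s where "w + ?two * v = s\<^sup>2" using dyadic_int_square[OF 2] by blast
      then have "w * 1\<^sup>2 + ?two * v * 1\<^sup>2 = s\<^sup>2" by simp
      then show ?thesis by (rule conic_of_padic_int) simp
    qed
    have "odd (residue u 3)" "odd (residue v 3)" using u v odd_iff by blast+
    then have "residue u 3 mod 8 = 1 \<or> (residue u 3 + 2 * residue v 3) mod 8 = 1 \<or>
        5 * residue u 3 mod 8 = 1 \<or> (5 * residue u 3 + 2 * residue v 3) mod 8 = 1"
      by (rule dyadic_twist_represents)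
    moreover have "residue u 3 mod 8 = residue u 3" using residue_mod_self[of u 3] by (simp add: 2)
    ultimately have "residue u 3 = 1 \<or> residue (u + ?two * v) 3 = 1 \<or>
        residue (?g * u) 3 = 1 \<or> residue (?g * u + ?two * v) 3 = 1"
      by (simp only: padic_int_ops_rep_eq r2 r5) (simp add: 2 mod_simps)
    then show ?thesis using sq by blast
  qed
  ultimately show ?thesis unfolding norm_twist_def by blast
qed

section \<open>Sign changes of the Hilbert symbol\<close>

lemma inverse_of_padic_int_unit:
  fixes u :: "'p::prime_card padic_int"
  assumes "residue u 1 \<noteq> 0"
  shows "inverse (of_padic_int u) \<in> Zp" "of_padic_int u \<noteq> 0"
proof -
  obtain t where "u * t = 1" using padic_int_unit[OF assms] by blast
  then have ut: "of_padic_int u * of_padic_int t = 1" by (metis of_padic_int_1 of_padic_int_mult)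
  then have "inverse (of_padic_int u) = of_padic_int t" by (rule inverse_unique)
  then show "inverse (of_padic_int u) \<in> Zp" by (simp add: Zp_def)
  show "of_padic_int u \<noteq> 0" using ut by auto
qed

lemma padic_val_unit_mult:
  fixes u :: "'p::prime_card padic_int"
  assumes "residue u 1 \<noteq> 0"
  shows "padic_val (of_nat CARD('p) powi k * of_padic_int u) = k"
  using inverse_of_padic_int_unit[OF assms] by (intro padic_val_eq) (simp_all add: Zp_def)

lemma padic_unit_decomp:
  fixes x :: "'p::prime_card padic"
  assumes "x \<noteq> 0"
  obtains u where "residue u 1 \<noteq> 0" "x = of_nat CARD('p) powi padic_val x * of_padic_int u"
proof -
  obtain k w where w: "x = of_nat CARD('p) powi k * w" "w \<in> Zp" "inverse w \<in> Zp" "w \<noteq> 0"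
    using padic_decomp[OF assms] by blast
  then obtain u t where ut: "w = of_padic_int u" "inverse w = of_padic_int t" by (auto simp: Zp_def)
  then have "of_padic_int (u * t) = of_padic_int 1"
    using w(4) by (simp add: of_padic_int_mult flip: ut)
  then have "u * t = 1" by (simp only: of_padic_int_eq_iff)
  then have "residue u 1 \<noteq> 0" unfolding padic_int_unit_iff by (metis dvd_triv_left)
  moreover have "padic_val x = k" using w padic_val_eq by blast
  ultimately show ?thesis using that w(1) ut(1) by blast
qed

lemma padic_val_mult:
  fixes x y :: "'p::prime_card padic"
  assumes "x \<noteq> 0" "y \<noteq> 0"
  shows "padic_val (x * y) = padic_val x + padic_val y"
proof -
  obtain u where u: "residue u 1 \<noteq> 0" "x = of_nat CARD('p) powi padic_val x * of_padic_int u"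
    using padic_unit_decomp[OF assms(1)] by blast
  obtain v where v: "residue v 1 \<noteq> 0" "y = of_nat CARD('p) powi padic_val y * of_padic_int v"
    using padic_unit_decomp[OF assms(2)] by blast
  have "x * y = of_nat CARD('p) powi (padic_val x + padic_val y) * of_padic_int (u * v)"
    by (subst u(2), subst v(2)) (simp add: of_padic_int_mult power_int_add ac_simps)
  moreover have "residue (u * v) 1 \<noteq> 0" using u v residue_mult_1_eq_0_iff by blast
  ultimately show ?thesis using padic_val_unit_mult by metis
qed

lemma padic_val_of_unit: "residue u 1 \<noteq> 0 \<Longrightarrow> padic_val (of_padic_int u) = 0"
  using padic_val_unit_mult[of u 0] by simp

lemma residue_minus_1: "residue (- u) 1 = 0 \<longleftrightarrow> residue u 1 = 0"
  by (simp only: residue_eq_0_iff_dvd dvd_minus_iff)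

lemma padic_val_minus: "padic_val (- x) = padic_val x"
proof (cases "x = 0")
  case False
  have "residue (- 1 :: 'a padic_int) 1 \<noteq> 0" by (subst residue_minus_1) (simp add: padic_int_unit_iff del: One_nat_def)
  then have "padic_val (of_padic_int (- 1) :: 'a padic) = 0" by (rule padic_val_of_unit)
  then have "padic_val (- 1 :: 'a padic) = 0" by (simp add: of_padic_int_minus)
  then show ?thesis using padic_val_mult[of "-1" x] False by simp
qed simp

lemma conic_even_power:
  fixes a b c :: "'a::field"
  assumes "c \<noteq> 0" "even k"
  shows "conic_has_point (c powi k * a) b \<longleftrightarrow> conic_has_point a b"
proof -
  obtain j where "k = j + j" using assms(2) by (metis evenE mult_2)
  moreover have "c powi (j + j) = c powi j * c powi j" by (intro power_int_add) (simp add: assms)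
  ultimately have "c powi k * a = a * (c powi j)\<^sup>2" by (simp only: power2_eq_square mult.commute)
  moreover have "conic_has_point (a * (c powi j)\<^sup>2) b \<longleftrightarrow> conic_has_point a b"
    by (rule conic_mult_square) (simp add: assms)
  ultimately show ?thesis by (simp only:)
qed

lemma conic_odd_power:
  fixes a b c :: "'a::field"
  assumes "c \<noteq> 0" "odd k"
  shows "conic_has_point (c powi k * a) b \<longleftrightarrow> conic_has_point (c * a) b"
proof -
  have "c powi k * a = c powi (k - 1) * (c * a)" using assms(1) by (simp add: power_int_diff)
  moreover have "conic_has_point (c powi (k - 1) * (c * a)) b \<longleftrightarrow> conic_has_point (c * a) b"
    by (rule conic_even_power) (use assms in simp_all)
  ultimately show ?thesis by (simp only:)
qed

lemma exists_norm_twist: "\<exists>g :: 'p::prime_card padic_int. norm_twist g"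
proof (cases "CARD('p) = 2")
  case True
  then show ?thesis by (rule norm_twist_dyadic)
next
  case False
  then have "odd CARD('p)"
    using prime_card_int[where 'a = 'p] primes_dvd_imp_eq[OF two_is_prime_nat, of "CARD('p)"] by auto
  then show ?thesis by (rule norm_twist_odd)
qed

text \<open>For \<open>a\<close> of even valuation, square factors reduce \<open>(a, b)\<close> to \<open>(u, p v)\<close> with units \<open>u\<close>, \<open>v\<close>. One of
  \<open>u\<close> and \<open>g u\<close> is a norm by the choice of \<open>g\<close>, and not both are, since then so would be \<open>g\<close>. For \<open>a\<close> of odd
  valuation, replace \<open>a\<close> by \<open>-a b\<close>.\<close>
theorem hilbert_symbol_unit_twist:
  "\<exists>g :: 'p::prime_card padic_int. residue g 1 \<noteq> 0 \<and>
    (\<forall>a b. a \<noteq> 0 \<longrightarrow> b \<noteq> 0 \<longrightarrow> odd (padic_val b) \<longrightarrow>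
      hilbert_symbol (of_padic_int g * a) b = - hilbert_symbol a b)"
proof -
  let ?p = "of_nat CARD('p) :: 'p padic"
  have p0: "?p \<noteq> 0" by simp
  obtain g :: "'p padic_int" where g: "residue g 1 \<noteq> 0"
    and g_non: "\<And>v. residue v 1 \<noteq> 0 \<Longrightarrow>
      \<not> conic_has_point (of_padic_int g) (of_padic_int (of_nat CARD('p) * v))"
    and g_or: "\<And>u v. residue u 1 \<noteq> 0 \<Longrightarrow> residue v 1 \<noteq> 0 \<Longrightarrow>
      conic_has_point (of_padic_int u) (of_padic_int (of_nat CARD('p) * v)) \<or>
      conic_has_point (of_padic_int (g * u)) (of_padic_int (of_nat CARD('p) * v))"
    using exists_norm_twist unfolding norm_twist_def by metis
  have "conic_has_point (of_padic_int g * a) b \<longleftrightarrow> \<not> conic_has_point a b"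
    if a: "a \<noteq> 0" and b: "b \<noteq> 0" "odd (padic_val b)" for a b
  proof -
    have even_case: "conic_has_point (of_padic_int g * c) b \<longleftrightarrow> \<not> conic_has_point c b"
      if c: "c \<noteq> 0" "even (padic_val c)" for c
    proof -
      obtain v where v: "residue v 1 \<noteq> 0" "b = ?p powi padic_val b * of_padic_int v"
        using padic_unit_decomp[OF b(1)] by blast
      obtain u where u: "residue u 1 \<noteq> 0" "c = ?p powi padic_val c * of_padic_int u"
        using padic_unit_decomp[OF c(1)] by blast
      have swap: "conic_has_point x b \<longleftrightarrow> conic_has_point x (of_padic_int (of_nat CARD('p) * v))" for x
        using conic_odd_power[OF p0 b(2), of "of_padic_int v" x] conic_commute
        by (metis v(2) of_padic_int_mult of_padic_int_of_nat)
      have 1: "conic_has_point c b \<longleftrightarrow> conic_has_point (of_padic_int u) b"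
        using conic_even_power[OF p0 c(2), of "of_padic_int u" b] u(2) by metis
      have gc: "of_padic_int g * c = ?p powi padic_val c * of_padic_int (g * u)"
        by (subst u(2)) (simp add: of_padic_int_mult ac_simps)
      have 2: "conic_has_point (of_padic_int g * c) b \<longleftrightarrow> conic_has_point (of_padic_int (g * u)) b"
        unfolding gc by (rule conic_even_power[OF p0 c(2)])
      show ?thesis
        unfolding 1 2 using g_or[OF u(1) v(1)] g_non[OF v(1)]
          conic_quotient[OF inverse_of_padic_int_unit(2)[OF u(1)], of b "of_padic_int g"]
        by (metis swap of_padic_int_mult)
    qed
    show ?thesis
    proof (cases "even (padic_val a)")
      case False
      have "padic_val (- a * b) = padic_val a + padic_val b"
        using padic_val_mult[of "- a" b] a b by (simp add: padic_val_minus)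
      then have "conic_has_point (of_padic_int g * (- a * b)) b \<longleftrightarrow> \<not> conic_has_point (- a * b) b"
        using False a b by (intro even_case) simp_all
      moreover have "of_padic_int g * (- a * b) = - (of_padic_int g * a) * b" by simp
      ultimately show ?thesis using conic_neg_mult[OF b(1)] by metis
    qed (rule even_case[OF a])
  qed
  with g show ?thesis by (auto simp: hilbert_symbol_conic)
qed

lemma int_square_mod_4: "x\<^sup>2 mod 4 = (if even x then 0 else 1)" for x :: int
proof (cases "even x")
  case True
  then obtain y where "x = 2 * y" by blast
  then show ?thesis by (simp add: power2_eq_square)
next
  case False
  then obtain y where "x = 2 * y + 1" by (rule oddE)
  then have "x\<^sup>2 = 1 + 4 * (y\<^sup>2 + y)" by (simp add: power2_eq_square algebra_simps)
  then have "x\<^sup>2 mod 4 = 1 mod 4" by (simp only: mod_mult_self2)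
  then show ?thesis using False by simp
qed

text \<open>If \<open>u\<close> and \<open>v\<close> are \<open>1\<close> modulo \<open>4\<close>, then one of \<open>u\<close>, \<open>v\<close>, \<open>u + 4 v\<close> is \<open>1\<close> modulo \<open>8\<close>, hence a square.
  If both are \<open>3\<close> modulo \<open>4\<close>, a primitive point would make \<open>x\<^sup>2 + y\<^sup>2 + z\<^sup>2\<close> divisible by \<open>4\<close>, and
  so all three coordinates even.\<close>
lemma conic_dyadic_units:
  fixes u v :: "'p::prime_card padic_int"
  assumes 2: "CARD('p) = 2" and u: "residue u 1 \<noteq> 0" and uv: "residue u 2 = residue v 2"
  shows "conic_has_point (of_padic_int u) (of_padic_int v) \<longleftrightarrow> residue u 2 = 1"
proof
  have m: "residue w 3 mod 4 = residue w 2" for w :: "'p padic_int"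
    using residue_mod[of 2 3 w] by (simp add: 2)
  have b: "residue w 3 \<in> {0..<8}" for w :: "'p padic_int" using residue_bounds[of w 3] by (simp add: 2)
  assume 1: "residue u 2 = 1"
  have r: "residue w 3 = 1 \<or> residue w 3 = 5" if "residue w 2 = 1" for w :: "'p padic_int"
    using m[of w] b[of w] that by (simp, presburger)
  have sq: "conic_has_point (of_padic_int w) b" if "residue w 3 = 1" for w :: "'p padic_int" and b
    using dyadic_int_square[OF 2 that] by (auto simp: of_padic_int_power conic_of_square)
  consider "residue u 3 = 1" | "residue v 3 = 1" | "residue u 3 = 5 \<and> residue v 3 = 5"
    using r[of u] r[of v] 1 uv by auto
  then show "conic_has_point (of_padic_int u) (of_padic_int v)"
  proof cases
    case 1 then show ?thesis by (rule sq)
  next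
    case 2 then show ?thesis using sq conic_commute by blast
  next
    case 3
    have r4: "residue (of_nat 4 :: 'p padic_int) 3 = 4" unfolding residue_of_nat by (simp add: 2)
    have "residue (u + v * of_nat 4) 3 = 1"
      by (simp only: padic_int_ops_rep_eq r4 3) (simp add: 2)
    then obtain s where s: "u + v * of_nat 4 = s\<^sup>2" using dyadic_int_square[OF 2] by blast
    show ?thesis by (rule conic_of_padic_int[of _ 1 _ 2 s]) (simp_all flip: s)
  qed
next
  assume "conic_has_point (of_padic_int u) (of_padic_int v)"
  then obtain X Y Z where eq: "Z\<^sup>2 = u * X\<^sup>2 + v * Y\<^sup>2"
    and prim: "residue X 1 \<noteq> 0 \<or> residue Y 1 \<noteq> 0 \<or> residue Z 1 \<noteq> 0"
    by (rule conic_primitive_solution)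
  have odd_iff: "residue w 1 = 0 \<longleftrightarrow> even (residue w 2)" for w :: "'p padic_int"
    using residue_1_eq_0_iff[of 2 w] 2 by simp
  have "residue u 2 \<in> {0..<4}" using residue_bounds[of u 2] by (simp add: 2)
  moreover have "odd (residue u 2)" using u odd_iff by blast
  ultimately have c: "residue u 2 = 1 \<or> residue u 2 = 3" by (simp, presburger)
  show "residue u 2 = 1"
  proof (rule ccontr)
    assume "residue u 2 \<noteq> 1"
    then have 3: "residue u 2 = 3" "residue v 2 = 3" using c uv by auto
    have "residue (Z\<^sup>2) 2 = residue (u * X\<^sup>2 + v * Y\<^sup>2) 2" by (simp only: eq)
    then have "(residue Z 2)\<^sup>2 mod 4 = (3 * (residue X 2)\<^sup>2 + 3 * (residue Y 2)\<^sup>2) mod 4"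
      by (simp only: padic_int_ops_rep_eq 3 power2_eq_square) (simp add: 2 mod_simps)
    also have "\<dots> = (3 * ((residue X 2)\<^sup>2 mod 4) + 3 * ((residue Y 2)\<^sup>2 mod 4)) mod 4"
      by (intro mod_add_cong) (simp_all add: mod_mult_right_eq)
    finally have "even (residue X 2) \<and> even (residue Y 2) \<and> even (residue Z 2)"
      unfolding int_square_mod_4 by (simp split: if_splits)
    then show False using prim odd_iff by blast
  qed
qed

lemma four_padic_int_nonzero: "(4 :: 'p::prime_card padic_int) \<noteq> 0"
proof
  assume "(4 :: 'p padic_int) = 0"
  then have "residue (of_nat 4 :: 'p padic_int) 3 = residue (0 :: 'p padic_int) 3" by simp
  then have "4 mod int CARD('p) ^ 3 = 0" unfolding residue_of_nat by (simp add: zero_padic_int.rep_eq)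
  moreover have "2 ^ 3 \<le> int CARD('p) ^ 3" using prime_card_gt_1_int[where 'p = 'p] by (intro power_mono) auto
  ultimately show False by simp
qed

lemma padic_symbol_commute: "padic_symbol t1 t2 = padic_symbol t2 t1"
  unfolding padic_symbol_def hilbert_symbol_conic
  using conic_commute[of t1 t2] padic_cong_sym[of _ _ 4] by (auto simp: conj_ac)

lemma padic_symbol_odd_val:
  "t1 \<noteq> 0 \<Longrightarrow> t2 \<noteq> 0 \<Longrightarrow> odd (padic_val t2) \<Longrightarrow> padic_symbol t1 t2 = hilbert_symbol t1 t2"
  by (simp add: padic_symbol_def)

text \<open>Negation preserves the relation of being congruent modulo \<open>4\<close> and interchanges the classes \<open>1\<close>
  and \<open>3\<close>, on which the symbol is \<open>1\<close> and \<open>-1\<close>.\<close>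
lemma padic_symbol_minus_dyadic:
  fixes t1 t2 :: "'p::prime_card padic"
  assumes 2: "CARD('p) = 2" and t: "t1 \<noteq> 0" "t2 \<noteq> 0" and even: "even (padic_val t1)" "even (padic_val t2)"
  shows "padic_symbol (- t1) (- t2) = - padic_symbol t1 t2"
proof -
  have p0: "(of_nat CARD('p) :: 'p padic) \<noteq> 0" by simp
  have four: "(4 :: 'p padic) = of_nat CARD('p) ^ 2" by (simp add: 2)
  have cong: "padic_cong (of_padic_int a) (of_padic_int b) 4 \<longleftrightarrow> residue a 2 = residue b 2" for a b :: "'p padic_int"
    using of_padic_int_in_coset[of a b 2] unfolding padic_coset_def four by simp
  have form: "padic_symbol (of_nat CARD('p) powi i * of_padic_int u) (of_nat CARD('p) powi j * of_padic_int v) =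
      (if residue u 2 \<noteq> residue v 2 then 0 else if residue u 2 = 1 then 1 else -1)"
    if u: "residue u 1 \<noteq> 0" and v: "residue v 1 \<noteq> 0" and ij: "even i" "even j" for i j and u v :: "'p padic_int"
  proof -
    define x y where xy: "x = of_nat CARD('p) powi i * of_padic_int u" "y = of_nat CARD('p) powi j * of_padic_int v"
    have nz: "x \<noteq> 0" "y \<noteq> 0" unfolding xy using inverse_of_padic_int_unit u v by auto
    have val: "padic_val x = i" "padic_val y = j" unfolding xy using padic_val_unit_mult u v by auto
    have two: "(2 :: 'p padic) = of_nat CARD('p)" by (simp add: 2)
    have d: "x / 2 powi i = of_padic_int u" "y / 2 powi j = of_padic_int v" unfolding two xy by simp_all
    have "conic_has_point x y \<longleftrightarrow> conic_has_point (of_padic_int u) (of_padic_int v)"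
      unfolding xy using conic_even_power[OF p0 ij(1)] conic_even_power[OF p0 ij(2)] conic_commute by metis
    then have "padic_symbol x y = (if residue u 2 \<noteq> residue v 2 then 0 else if residue u 2 = 1 then 1 else -1)"
      unfolding padic_symbol_def val d cong hilbert_symbol_conic using nz ij 2 conic_dyadic_units[OF 2 u, of v] by simp
    then show ?thesis unfolding xy .
  qed
  obtain u where u: "residue u 1 \<noteq> 0" "t1 = of_nat CARD('p) powi padic_val t1 * of_padic_int u"
    using padic_unit_decomp[OF t(1)] by blast
  obtain v where v: "residue v 1 \<noteq> 0" "t2 = of_nat CARD('p) powi padic_val t2 * of_padic_int v"
    using padic_unit_decomp[OF t(2)] by blast
  have mu: "residue (- u) 1 \<noteq> 0" "residue (- v) 1 \<noteq> 0" using u v residue_minus_1 by blast+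
  have eq: "padic_symbol t1 t2 = (if residue u 2 \<noteq> residue v 2 then 0 else if residue u 2 = 1 then 1 else -1)"
    using form[OF u(1) v(1) even] u(2) v(2) by metis
  have "- t1 = of_nat CARD('p) powi padic_val t1 * of_padic_int (- u)"
    "- t2 = of_nat CARD('p) powi padic_val t2 * of_padic_int (- v)"
    using u(2) v(2) by (simp_all add: of_padic_int_minus)
  then have neg: "padic_symbol (- t1) (- t2) =
      (if residue (- u) 2 \<noteq> residue (- v) 2 then 0 else if residue (- u) 2 = 1 then 1 else -1)"
    using form[OF mu even] by metis
  have range: "residue w 2 = 1 \<and> residue (- w) 2 = 3 \<or> residue w 2 = 3 \<and> residue (- w) 2 = 1"
    if "residue w 1 \<noteq> 0" for w :: "'p padic_int"
  proof -
    have "odd (residue w 2)" using residue_1_eq_0_iff[of 2 w] 2 that by simp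
    moreover have "residue w 2 \<in> {0..<4}" using residue_bounds[of w 2] by (simp add: 2)
    ultimately have "residue w 2 = 1 \<or> residue w 2 = 3" by (simp, presburger)
    moreover have "residue (- w) 2 = (- residue w 2) mod 4" by (simp add: uminus_padic_int.rep_eq 2)
    ultimately show ?thesis by auto
  qed
  show ?thesis using range[OF u(1)] range[OF v(1)] unfolding eq neg by auto
qed

section \<open>Local constancy\<close>

text \<open>The factor is the square of a unit, and for \<open>p = 2\<close> it is \<open>1\<close> modulo \<open>4\<close>, so it affects neither the
  conic nor the congruence in the definition of the symbol.\<close>
lemma padic_symbol_square_class:
  fixes t1 t2 :: "'p::prime_card padic"
  assumes "z \<in> Zp" "t1 \<noteq> 0"
  defines "q \<equiv> 1 + 4 * (of_nat CARD('p) * z)"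
  shows "t1 * q \<noteq> 0" "padic_val (t1 * q) = padic_val t1" "padic_symbol (t1 * q) t2 = padic_symbol t1 t2"
proof -
  obtain m where m: "z = of_padic_int m" using assms(1) by (auto simp: Zp_def)
  define Q where "Q = 1 + of_nat 4 * (of_nat CARD('p) * m)"
  have q: "q = of_padic_int Q"
    unfolding q_def m Q_def by (simp only: of_padic_int_add of_padic_int_mult of_padic_int_of_nat of_padic_int_1) simp
  have "Q - 1 = of_nat CARD('p) ^ 1 * (of_nat 4 * m)" by (simp add: Q_def)
  then have "residue Q 1 = residue (1 :: 'p padic_int) 1"
    unfolding residue_eq_iff_dvd by (metis dvd_triv_left)
  then have Q1: "residue Q 1 \<noteq> 0" using padic_int_unit_iff[of "1 :: 'p padic_int"] by simp
  have q0: "q \<noteq> 0" using inverse_of_padic_int_unit[OF Q1] q by simp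
  then show nz: "t1 * q \<noteq> 0" using assms(2) by simp
  show val: "padic_val (t1 * q) = padic_val t1"
    using padic_val_mult[OF assms(2) q0] padic_val_of_unit[OF Q1] q by simp
  obtain s where "s\<^sup>2 = Q" using padic_int_sqrt[of m] by (auto simp: Q_def)
  then have s: "q = (of_padic_int s)\<^sup>2" using q by (simp flip: of_padic_int_power)
  then have "of_padic_int s \<noteq> 0" using q0 by auto
  then have conic: "conic_has_point (t1 * q) t2 \<longleftrightarrow> conic_has_point t1 t2"
    unfolding s by (rule conic_mult_square)
  have cong: "padic_cong (t1 * q / 2 powi padic_val t1) y 4 \<longleftrightarrow> padic_cong (t1 / 2 powi padic_val t1) y 4"
    if 2: "CARD('p) = 2" for y
  proof -
    obtain u where u: "residue u 1 \<noteq> 0" "t1 = of_nat CARD('p) powi padic_val t1 * of_padic_int u"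
      using padic_unit_decomp[OF assms(2)] by blast
    have "t1 / of_nat CARD('p) powi padic_val t1 = of_padic_int u"
      by (subst u(2)) simp
    then have "t1 / 2 powi padic_val t1 = of_padic_int u" by (simp add: 2)
    moreover have "t1 * q / 2 powi padic_val t1 = (t1 / 2 powi padic_val t1) * q" by simp
    ultimately have "t1 * q / 2 powi padic_val t1 - t1 / 2 powi padic_val t1 = of_padic_int u * q - of_padic_int u"
      by (simp only:)
    also have "\<dots> = 4 * (of_padic_int u * (of_nat CARD('p) * z))" by (simp add: q_def algebra_simps)
    finally have "t1 * q / 2 powi padic_val t1 - t1 / 2 powi padic_val t1 = 4 * (of_padic_int u * (of_nat CARD('p) * z))" .
    moreover have "of_padic_int u * (of_nat CARD('p) * z) \<in> Zp"
      by (intro Zp_mult assms(1) Zp_of_nat) (simp add: Zp_def)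
    ultimately have "padic_cong (t1 * q / 2 powi padic_val t1) (t1 / 2 powi padic_val t1) 4"
      unfolding padic_cong_def by blast
    then show ?thesis using padic_cong_trans padic_cong_sym by blast
  qed
  show "padic_symbol (t1 * q) t2 = padic_symbol t1 t2"
  proof (cases "CARD('p) = 2")
    case True
    show ?thesis
      unfolding padic_symbol_def val hilbert_symbol_conic conic cong[OF True] using nz assms(2) by simp
  next
    case False
    then show ?thesis unfolding padic_symbol_def val hilbert_symbol_conic conic using nz assms(2) by simp
  qed
qed

lemma padic_symbol_locally_constant:
  fixes t1 :: "'p::prime_card padic"
  assumes "t1 \<noteq> 0"
  shows "\<exists>n. \<forall>s \<in> padic_coset t1 n. s \<noteq> 0 \<and> padic_val s = padic_val t1 \<and>
    (\<forall>t2. padic_symbol s t2 = padic_symbol t1 t2)"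
proof -
  have "of_padic_int (of_nat 4) \<noteq> (of_padic_int 0 :: 'p padic)"
    using four_padic_int_nonzero by (simp only: of_padic_int_eq_iff) simp
  then have "(of_nat 4 :: 'p padic) \<noteq> 0" by (simp only: of_padic_int_of_nat of_padic_int_0 not_False_eq_True)
  then have 4: "(4 :: 'p padic) \<noteq> 0" by simp
  obtain n where n: "of_nat CARD('p) ^ n * inverse (t1 * (4 * of_nat CARD('p))) \<in> Zp" using padic_denominator by blast
  have "s \<noteq> 0 \<and> padic_val s = padic_val t1 \<and> (\<forall>t2. padic_symbol s t2 = padic_symbol t1 t2)"
    if "s \<in> padic_coset t1 n" for s
  proof -
    have "padic_cong s t1 (of_nat CARD('p) ^ n)" using that by (simp add: padic_coset_def)
    then obtain w where w: "w \<in> Zp" "s - t1 = of_nat CARD('p) ^ n * w"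
      unfolding padic_cong_def by blast
    define z where "z = of_nat CARD('p) ^ n * inverse (t1 * (4 * of_nat CARD('p))) * w"
    have "t1 * (1 + 4 * (of_nat CARD('p) * z)) = t1 + of_nat CARD('p) ^ n * w"
      using assms 4 by (simp add: z_def field_simps)
    then have "s = t1 * (1 + 4 * (of_nat CARD('p) * z))" using w(2) by (simp add: algebra_simps)
    then show ?thesis using padic_symbol_square_class[of z t1] assms Zp_mult[OF n w(1)] by (simp add: z_def)
  qed
  then show ?thesis by blast
qed

section \<open>Haar measure and multiplication by units\<close>

lemma sets_padic_haar [measurable_cong]: "sets (padic_haar :: 'p::prime_card padic measure) = sets borel"
  using padic_haar_measure_padic_haar[where 'a = 'p] by (simp add: padic_haar_measure_def)

lemma space_padic_haar: "space padic_haar = UNIV"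
  using sets_eq_imp_space_eq[OF sets_padic_haar] by simp

lemma sigma_finite_padic_haar: "sigma_finite_measure (padic_haar :: 'p::prime_card padic measure)"
proof
  let ?A = "range (\<lambda>q. padic_coset (padic_frac q :: 'p padic) 0)"
  have "x \<in> \<Union>?A" for x
  proof -
    obtain q where "padic_frac q \<in> padic_coset x 0" using padic_frac_dense by blast
    then have "x \<in> padic_coset (padic_frac q) 0" using padic_coset_eq[of "padic_frac q" x 0] by simp
    then show ?thesis by blast
  qed
  then have "\<Union>?A = space padic_haar" by (auto simp: space_padic_haar)
  then show "\<exists>A. countable A \<and> A \<subseteq> sets padic_haar \<and> \<Union>A = space (padic_haar :: 'p padic measure) \<and>
      (\<forall>a\<in>A. emeasure padic_haar a \<noteq> \<infinity>)"
    by (intro exI[of _ ?A])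
      (auto simp: sets_padic_haar padic_haar_measure_coset[OF padic_haar_measure_padic_haar])
qed

lemma padic_coset_unit_mult:
  assumes "u \<in> Zp" "inverse u \<in> Zp" "u \<noteq> 0"
  shows "u * x \<in> padic_coset c n \<longleftrightarrow> x \<in> padic_coset (c / u) n"
proof -
  have *: "u * x \<in> padic_coset (u * c) n" if "u \<in> Zp" "x \<in> padic_coset c n" for u x c :: "'a padic"
  proof -
    obtain z where z: "z \<in> Zp" "x - c = of_nat CARD('a) ^ n * z"
      using \<open>x \<in> padic_coset c n\<close> unfolding padic_coset_def padic_cong_def by blast
    have "u * x - u * c = of_nat CARD('a) ^ n * (u * z)"
      using z(2) by (simp flip: right_diff_distrib)
    then show ?thesis using Zp_mult[OF that(1) z(1)] unfolding padic_coset_def padic_cong_def by blast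
  qed
  have "u * (c / u) = c" "inverse u * (u * x) = x" "inverse u * c = c / u"
    using assms(3) by (simp_all add: field_simps)
  then show ?thesis using *[OF assms(1), of x "c / u"] *[OF assms(2), of "u * x" c] by (simp only:) blast
qed

text \<open>Multiplication by a unit permutes the cosets of each \<open>p\<^sup>n \<int>\<^sub>p\<close>, which all have measure \<open>1/p\<^sup>n\<close>.\<close>
lemma distr_padic_haar_unit_mult:
  fixes u :: "'p::prime_card padic"
  assumes u: "u \<in> Zp" "inverse u \<in> Zp" "u \<noteq> 0"
  shows "(*) u \<in> borel \<rightarrow>\<^sub>M borel" "distr padic_haar borel ((*) u) = padic_haar"
proof -
  have pre: "(*) u -` padic_coset c n = padic_coset (c / u) n" for c n
    using padic_coset_unit_mult[OF u] by auto
  show meas: "(*) u \<in> borel \<rightarrow>\<^sub>M borel"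
    by (rule measurable_sigma_sets[OF sets_borel_padic]) (auto simp: padic_cosets_def pre)
  have "(*) u \<in> padic_haar \<rightarrow>\<^sub>M borel" using meas measurable_cong_sets[OF sets_padic_haar refl] by blast
  then have "emeasure (distr padic_haar borel ((*) u)) (padic_coset c n) = emeasure padic_haar (padic_coset c n)" for c n
    by (subst emeasure_distr)
      (simp_all add: pre space_padic_haar padic_haar_measure_coset[OF padic_haar_measure_padic_haar])
  then show "distr padic_haar borel ((*) u) = padic_haar"
    by (intro padic_measure_eqI)
      (simp_all add: sets_padic_haar padic_haar_measure_coset[OF padic_haar_measure_padic_haar])
qed

lemma emeasure_padic_haar_pair_unit_mult:
  fixes u v :: "'p::prime_card padic"
  assumes u: "u \<in> Zp" "inverse u \<in> Zp" "u \<noteq> 0" and v: "v \<in> Zp" "inverse v \<in> Zp" "v \<noteq> 0"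
    and S: "S \<in> sets (borel \<Otimes>\<^sub>M borel)"
  shows "emeasure (padic_haar \<Otimes>\<^sub>M padic_haar) {(x, y). (u * x, v * y) \<in> S} =
    emeasure (padic_haar \<Otimes>\<^sub>M padic_haar) S"
proof -
  let ?P = "padic_haar \<Otimes>\<^sub>M padic_haar :: ('p padic \<times> 'p padic) measure"
  let ?f = "\<lambda>(x, y). (u * x, v * y)"
  have meas: "(*) u \<in> padic_haar \<rightarrow>\<^sub>M borel" "(*) v \<in> padic_haar \<rightarrow>\<^sub>M borel"
    using distr_padic_haar_unit_mult(1) u v measurable_cong_sets[OF sets_padic_haar refl] by blast+
  have "?P = distr ?P (borel \<Otimes>\<^sub>M borel) ?f"
    using pair_measure_distr[OF meas] sigma_finite_padic_haar
    by (simp add: distr_padic_haar_unit_mult(2)[OF u] distr_padic_haar_unit_mult(2)[OF v])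
  then have "emeasure ?P S = emeasure (distr ?P (borel \<Otimes>\<^sub>M borel) ?f) S" by (rule arg_cong)
  also have "\<dots> = emeasure ?P (?f -` S \<inter> space ?P)"
  proof (rule emeasure_distr[OF _ S])
    show "?f \<in> ?P \<rightarrow>\<^sub>M borel \<Otimes>\<^sub>M borel"
      unfolding split_beta by (intro measurable_Pair measurable_compose[OF measurable_fst meas(1)] measurable_compose[OF measurable_snd meas(2)])
  qed
  also have "?f -` S \<inter> space ?P = {(x, y). (u * x, v * y) \<in> S}"
    by (auto simp: space_pair_measure space_padic_haar)
  finally show ?thesis ..
qed

text \<open>There are only countably many cosets, so such a set is a countable union of rectangles.\<close>
lemma padic_pair_set_measurable:
  fixes S :: "('p::prime_card padic \<times> 'p padic) set"
  assumes S: "\<And>x y. (x, y) \<in> S \<Longrightarrow> \<exists>m n. padic_coset x m \<times> padic_coset y n \<subseteq> S"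
  shows "S \<in> sets (borel \<Otimes>\<^sub>M borel)"
proof -
  let ?F = "{B \<in> (\<lambda>(A, B). A \<times> B) ` (padic_cosets \<times> padic_cosets). B \<subseteq> S}"
  have "countable ?F"
    by (rule countable_subset[of _ "(\<lambda>(A, B). A \<times> B) ` (padic_cosets \<times> padic_cosets)"])
      (auto intro: padic_cosets_countable)
  moreover have "B \<in> sets (borel \<Otimes>\<^sub>M borel)" if "B \<in> ?F" for B
    using that by (auto simp: padic_cosets_def)
  ultimately have "\<Union>?F \<in> sets (borel \<Otimes>\<^sub>M borel)" by (intro sets.countable_Union) auto
  moreover have "S \<subseteq> \<Union>?F"
  proof
    fix t assume t: "t \<in> S"
    obtain x y where xy: "t = (x, y)" by fastforce
    then obtain m n where "padic_coset x m \<times> padic_coset y n \<subseteq> S" using S t by blast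
    moreover have "padic_coset x m \<in> padic_cosets" "padic_coset y n \<in> padic_cosets"
      by (auto simp: padic_cosets_def)
    ultimately have "padic_coset x m \<times> padic_coset y n \<in> ?F" by blast
    moreover have "t \<in> padic_coset x m \<times> padic_coset y n" using xy by simp
    ultimately show "t \<in> \<Union>?F" by blast
  qed
  then have "S = \<Union>?F" by blast
  ultimately show ?thesis by simp
qed

text \<open>With \<open>N\<close> at least \<open>-k\<close>, the elements of valuation \<open>k\<close> lie in \<open>p\<^sup>-\<^sup>N \<int>\<^sub>p\<close>, which is covered by the
  \<open>p\<^sup>N\<close> cosets of \<open>\<int>\<^sub>p\<close> represented by \<open>i/p\<^sup>N\<close>.\<close>
lemma padic_val_sphere_finite_measure:
  "\<exists>W \<in> sets padic_haar. emeasure padic_haar W < \<infinity> \<and> {x :: 'p::prime_card padic. x \<noteq> 0 \<and> padic_val x = k} \<subseteq> W"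
proof -
  define N where "N = nat (- k)"
  let ?W = "\<Union>i<CARD('p) ^ N. padic_coset (padic_frac (i, N) :: 'p padic) 0"
  have "x \<in> ?W" if x: "x \<noteq> 0" "padic_val x = k" for x
  proof -
    obtain u where u: "x = of_nat CARD('p) powi k * of_padic_int u"
      using padic_unit_decomp[OF x(1)] x(2) by metis
    have "of_nat CARD('p) ^ N * x = of_nat CARD('p) powi (int N + k) * of_padic_int u"
      by (simp add: u power_int_add flip: power_int_of_nat)
    also have "\<dots> \<in> Zp" by (intro Zp_mult) (simp_all add: power_Zp_nonunit N_def Zp_def[symmetric], simp add: Zp_def)
    finally obtain a where a: "of_nat CARD('p) ^ N * x = of_padic_int a" by (auto simp: Zp_def)
    define i where "i = nat (residue a N)"
    have "int i < int (CARD('p) ^ N)" using residue_bounds[of a N] by (simp add: i_def)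
    then have i: "i < CARD('p) ^ N" by (simp only: of_nat_less_iff)
    have "padic_cong (of_padic_int a) (of_nat i) (of_nat CARD('p) ^ N)"
      using padic_int_approx[of a N] unfolding padic_coset_def i_def by blast
    then obtain z where z: "z \<in> Zp" "of_nat CARD('p) ^ N * x - of_nat i = of_nat CARD('p) ^ N * z"
      unfolding padic_cong_def a by blast
    have "x - padic_frac (i, N) = z"
      using z(2) unfolding padic_frac_def by (simp add: field_simps)
    then have "x \<in> padic_coset (padic_frac (i, N)) 0" using z(1) by (simp add: padic_coset_0)
    then show ?thesis using i by blast
  qed
  moreover have "emeasure padic_haar ?W < \<infinity>"
  proof -
    have "emeasure padic_haar ?W \<le> (\<Sum>i<CARD('p) ^ N. emeasure padic_haar (padic_coset (padic_frac (i, N) :: 'p padic) 0))"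
      by (intro emeasure_subadditive_finite) (auto simp: sets_padic_haar)
    also have "\<dots> = of_nat (CARD('p) ^ N)"
      by (simp add: padic_haar_measure_coset[OF padic_haar_measure_padic_haar])
    also have "\<dots> < \<infinity>" by (simp only: infinity_ennreal_def of_nat_less_top)
    finally show ?thesis .
  qed
  moreover have "?W \<in> sets padic_haar" by (simp add: sets_padic_haar)
  ultimately show ?thesis by blast
qed

section \<open>The integral\<close>

definition padic_symbol_level :: "int \<Rightarrow> int \<Rightarrow> int \<Rightarrow> ('p::prime_card padic \<times> 'p padic) set" where
  "padic_symbol_level \<beta>1 \<beta>2 c = {(t1, t2). t1 \<noteq> 0 \<and> t2 \<noteq> 0 \<and>
    padic_val t1 = \<beta>1 \<and> padic_val t2 = \<beta>2 \<and> padic_symbol t1 t2 = c}"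

lemma padic_symbol_level_measurable: "padic_symbol_level \<beta>1 \<beta>2 c \<in> sets (borel \<Otimes>\<^sub>M borel)"
proof (rule padic_pair_set_measurable)
  fix x y :: "'a padic"
  assume xy: "(x, y) \<in> padic_symbol_level \<beta>1 \<beta>2 c"
  then have "x \<noteq> 0" "y \<noteq> 0" by (auto simp: padic_symbol_level_def)
  then obtain m n where
    m: "\<forall>s\<in>padic_coset x m. s \<noteq> 0 \<and> padic_val s = padic_val x \<and> (\<forall>t. padic_symbol s t = padic_symbol x t)" and
    n: "\<forall>s\<in>padic_coset y n. s \<noteq> 0 \<and> padic_val s = padic_val y \<and> (\<forall>t. padic_symbol s t = padic_symbol y t)"
    using padic_symbol_locally_constant[of x] padic_symbol_locally_constant[of y] by blast
  have "(s, t) \<in> padic_symbol_level \<beta>1 \<beta>2 c" if "s \<in> padic_coset x m" "t \<in> padic_coset y n" for s t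
  proof -
    have "padic_symbol s t = padic_symbol x y"
      using bspec[OF m that(1)] bspec[OF n that(2)] padic_symbol_commute[of x] by simp
    then show ?thesis
      using xy bspec[OF m that(1)] bspec[OF n that(2)] by (simp add: padic_symbol_level_def)
  qed
  then show "\<exists>m n. padic_coset x m \<times> padic_coset y n \<subseteq> padic_symbol_level \<beta>1 \<beta>2 c" by blast
qed

lemma padic_symbol_level_finite:
  "emeasure (padic_haar \<Otimes>\<^sub>M padic_haar) (padic_symbol_level \<beta>1 \<beta>2 c :: ('p::prime_card padic \<times> 'p padic) set) < \<infinity>"
proof -
  let ?H = "padic_haar :: 'p padic measure"
  obtain V where V: "V \<in> sets ?H" "emeasure ?H V < \<infinity>" "{x. x \<noteq> 0 \<and> padic_val x = \<beta>1} \<subseteq> V"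
    using padic_val_sphere_finite_measure by blast
  obtain W where W: "W \<in> sets ?H" "emeasure ?H W < \<infinity>" "{x. x \<noteq> 0 \<and> padic_val x = \<beta>2} \<subseteq> W"
    using padic_val_sphere_finite_measure by blast
  have "padic_symbol_level \<beta>1 \<beta>2 c \<subseteq> V \<times> W" using V(3) W(3) by (auto simp: padic_symbol_level_def)
  then have "emeasure (?H \<Otimes>\<^sub>M ?H) (padic_symbol_level \<beta>1 \<beta>2 c) \<le> emeasure (?H \<Otimes>\<^sub>M ?H) (V \<times> W)"
    using V(1) W(1) by (intro emeasure_mono) auto
  also have "\<dots> = emeasure ?H V * emeasure ?H W"
    using V(1) W(1) by (rule sigma_finite_measure.emeasure_pair_measure_Times[OF sigma_finite_padic_haar])
  also have "\<dots> < \<infinity>" using V(2) W(2) by (simp add: ennreal_mult_less_top)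
  finally show ?thesis .
qed

text \<open>A pair of units whose multiplication changes the sign of the symbol carries one level set onto the
  other: \<open>(1, g)\<close> or \<open>(g, 1)\<close> with \<open>g\<close> twisting norms if some valuation is odd, and \<open>(-1, -1)\<close> if \<open>p = 2\<close>
  and both are even. In the remaining case both level sets are empty.\<close>
lemma padic_symbol_level_balanced:
  "emeasure (padic_haar \<Otimes>\<^sub>M padic_haar) (padic_symbol_level \<beta>1 \<beta>2 1 :: ('p::prime_card padic \<times> 'p padic) set) =
    emeasure (padic_haar \<Otimes>\<^sub>M padic_haar) (padic_symbol_level \<beta>1 \<beta>2 (-1) :: ('p padic \<times> 'p padic) set)"
proof -
  have balance: ?thesis
    if u: "residue u 1 \<noteq> 0" and v: "residue v 1 \<noteq> 0"
      and flip: "\<And>t1 t2. t1 \<noteq> 0 \<Longrightarrow> t2 \<noteq> 0 \<Longrightarrow> padic_val t1 = \<beta>1 \<Longrightarrow> padic_val t2 = \<beta>2 \<Longrightarrow>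
        padic_symbol (of_padic_int u * t1) (of_padic_int v * t2) = - padic_symbol t1 t2"
    for u v :: "'p padic_int"
  proof -
    have val: "of_padic_int w * t \<noteq> 0 \<longleftrightarrow> t \<noteq> 0" "t \<noteq> 0 \<Longrightarrow> padic_val (of_padic_int w * t) = padic_val t"
      if "residue w 1 \<noteq> 0" for w :: "'p padic_int" and t
      using inverse_of_padic_int_unit(2)[OF that] padic_val_mult[of "of_padic_int w" t] padic_val_of_unit[OF that]
      by auto
    have "{(x, y). (of_padic_int u * x, of_padic_int v * y) \<in> padic_symbol_level \<beta>1 \<beta>2 (-1)} =
        padic_symbol_level \<beta>1 \<beta>2 1"
      unfolding padic_symbol_level_def using val[OF u] val[OF v] flip by fastforce
    then show ?thesis
      using emeasure_padic_haar_pair_unit_mult[OF _ inverse_of_padic_int_unit[OF u] _ inverse_of_padic_int_unit[OF v]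
          padic_symbol_level_measurable[of \<beta>1 \<beta>2 "-1"]]
      by (simp add: Zp_def)
  qed
  obtain g :: "'p padic_int" where g: "residue g 1 \<noteq> 0" and twist: "\<And>a b. a \<noteq> 0 \<Longrightarrow> b \<noteq> 0 \<Longrightarrow> odd (padic_val b) \<Longrightarrow>
      hilbert_symbol (of_padic_int g * a) b = - hilbert_symbol a b"
    using hilbert_symbol_unit_twist by blast
  have one: "residue (1 :: 'p padic_int) 1 \<noteq> 0" "residue (- 1 :: 'p padic_int) 1 \<noteq> 0"
    unfolding padic_int_unit_iff by simp_all
  have g0: "of_padic_int g \<noteq> 0" using inverse_of_padic_int_unit(2)[OF g] .
  have twist_symbol: "padic_symbol (of_padic_int g * a) b = - padic_symbol a b"
    if "a \<noteq> 0" "b \<noteq> 0" "odd (padic_val b)" for a b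
    using that g0 twist by (simp add: padic_symbol_odd_val)
  consider "odd \<beta>2" | "odd \<beta>1" | "even \<beta>1" "even \<beta>2" "CARD('p) = 2" | "even \<beta>1" "even \<beta>2" "odd CARD('p)"
    using prime_card_int[where 'a = 'p] primes_dvd_imp_eq[OF two_is_prime_nat, of "CARD('p)"] by force
  then show ?thesis
  proof cases
    case 1
    then show ?thesis by (intro balance[OF g one(1)]) (simp add: twist_symbol)
  next
    case 2
    then show ?thesis
      by (intro balance[OF one(1) g]) (metis mult_1 of_padic_int_1 padic_symbol_commute twist_symbol)
  next
    case 3
    then show ?thesis
      by (intro balance[OF one(2) one(2)]) (simp add: of_padic_int_minus padic_symbol_minus_dyadic)
  next
    case 4
    then have "padic_symbol_level \<beta>1 \<beta>2 c = ({} :: ('p padic \<times> 'p padic) set)" if "c \<noteq> 0" for c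
      using that by (auto simp: padic_symbol_level_def padic_symbol_def)
    then show ?thesis by simp
  qed
qed

theorem lemma1p9:
  fixes \<beta>1 \<beta>2 :: int and D :: "('p::prime_card padic \<times> 'p padic) set"
  defines "D \<equiv> {(t1, t2). t1 \<noteq> 0 \<and> t2 \<noteq> 0 \<and> padic_val t1 = \<beta>1 \<and> padic_val t2 = \<beta>2}"
  shows "set_integrable (padic_haar \<Otimes>\<^sub>M padic_haar) D (\<lambda>(t1, t2). real_of_int (padic_symbol t1 t2))
    \<and> (LINT t:D|padic_haar \<Otimes>\<^sub>M padic_haar. (case t of (t1, t2) \<Rightarrow> real_of_int (padic_symbol t1 t2))) = 0"
proof -
  let ?P = "padic_haar \<Otimes>\<^sub>M padic_haar :: ('p padic \<times> 'p padic) measure"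
  let ?L = "padic_symbol_level \<beta>1 \<beta>2 :: int \<Rightarrow> ('p padic \<times> 'p padic) set"
  have "padic_symbol t1 t2 \<in> {-1, 0, 1}" for t1 t2 :: "'p padic"
    by (simp add: padic_symbol_def hilbert_symbol_def)
  then have split: "(\<lambda>t. indicat_real D t *\<^sub>R (case t of (t1, t2) \<Rightarrow> real_of_int (padic_symbol t1 t2))) =
      (\<lambda>t. indicat_real (?L 1) t - indicat_real (?L (-1)) t)"
    by (fastforce simp: fun_eq_iff D_def padic_symbol_level_def indicator_def)
  have sets: "?L c \<in> sets ?P" for c
    using padic_symbol_level_measurable sets_pair_measure_cong[OF sets_padic_haar sets_padic_haar] by metis
  have int: "integrable ?P (indicat_real (?L c))" for c
    by (rule integrable_real_indicator[OF sets padic_symbol_level_finite])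
  have "(LINT t|?P. indicat_real (?L 1) t - indicat_real (?L (-1)) t) = measure ?P (?L 1) - measure ?P (?L (-1))"
    using int by (simp add: space_pair_measure space_padic_haar)
  also have "\<dots> = 0" by (simp add: measure_def padic_symbol_level_balanced)
  finally show ?thesis
    unfolding set_integrable_def set_lebesgue_integral_def split using int by simp
qed

end
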